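(* Let $n>1$ and $d\ge 2$ be integers, let $r\in\{1,-1\}$ with $n\equiv r\pmod d$, and let $a,c,e$ be indeterminates. Define \begin{align*} Q_q(a,n)&=\frac{{q^{r(r-n)/d}}\left(1-aq^n\right)\left(a-q^n\right)}{(1-a)^2} \left\{\frac{1}{\left(q^d;q^d\right)_{(n-r)/d}}-\frac{\left(q^d;q^d\right)_{(n-r)/d}}{\left(q^d/a,aq^d;q^d\right)_{(n-r)/d}}\right\} +\frac{q^{r(r-n)/d}}{\left(q^d;q^d\right)_{(n-r)/d}}. \end{align*} Then, modulo $\Phi_n(q)^2(1-aq^n)(a-q^n)$, \begin{align*} &\sum_{k=0}^{(n-r)/d}[2dk+r]\frac{\left(q^r;q^d\right)^2_k\left(cq^r,eq^r,aq^r,q^r/a;q^d\right)_k} {\left(q^d;q^d\right)^2_k\left(q^d/c,q^d/e,q^d/a,aq^d;q^d\right)_k} \left(\frac{q^{2d-3r}}{ce}\right)^k\\ &\equiv[n]Q_q(a,n) \sum_{k=0}^{(n-r)/d}\frac{\left(q^{2r+dk};q^d\right)_{(n-r)/d-k}\left(q^{d-r}/(ce),aq^r,q^r/a,q^r;q^d\right)_k}{\left(q^d,q^d/c,q^d/e;q^d\right)_k}q^{dk}. \end{align*}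
   Context: $q$ is an indeterminate. The $q$-shifted factorial is $(x;q)_0=1$, $(x;q)_m=(1-x)(1-xq)\cdots(1-xq^{m-1})$ for positive integers $m$, and $(x_1,\dots,x_s;q)_m=(x_1;q)_m\cdots(x_s;q)_m$; $(x;q)_m^j$ means $((x;q)_m)^j$. For an integer $m$, $[m]=(1-q^m)/(1-q)$. $\Phi_n(q)$ is the $n$-th cyclotomic polynomial. For rational functions $A,B$ in $q,a,c,e$ and a polynomial $P$, $A\equiv B \pmod P$ means that $A-B=P\cdot F/G$ with $F,G$ polynomials and $G$ coprime to $P$. *)

theory Defs
  imports "HOL-Computational_Algebra.Computational_Algebra"
begin

text \<open>Polynomials over the rationals in the four indeterminates e, c, a, q (nested univariate
  polynomials), and their field of fractions (the rational functions in q, a, c, e).\<close>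

type_synonym mpoly4 = "rat poly poly poly poly"
type_synonym rfun4 = "mpoly4 fract"

definition cR :: "rat \<Rightarrow> mpoly4" where "cR x = [:[:[:[:x:]:]:]:]"

definition Ve :: mpoly4 where "Ve = [:0, 1:]"
definition Vc :: mpoly4 where "Vc = [:[:0, 1:]:]"
definition Va :: mpoly4 where "Va = [:[:[:0, 1:]:]:]"
definition Vq :: mpoly4 where "Vq = [:[:[:[:0, 1:]:]:]:]"

definition emb :: "mpoly4 \<Rightarrow> rfun4" where "emb p = Fract p 1"

text \<open>Cyclotomic polynomials over the rationals: x^n - 1 = product of cyclo d over d dividing n.\<close>
function cyclo :: "nat \<Rightarrow> rat poly" where
  "cyclo n = (if n = 0 then 1 else
     (monom 1 n - 1) div (\<Prod>d\<in>{d. d dvd n \<and> d < n}. cyclo d))"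
  by auto
termination
  by (relation "measure id") auto

definition PhiQ :: "nat \<Rightarrow> mpoly4" where "PhiQ n = poly (map_poly cR (cyclo n)) Vq"

definition qpoch :: "'a::comm_ring_1 \<Rightarrow> 'a \<Rightarrow> nat \<Rightarrow> 'a" where
  "qpoch x b m = (\<Prod>i<m. 1 - x * b ^ i)"

definition qint :: "'a::field \<Rightarrow> int \<Rightarrow> 'a" where
  "qint q m = (1 - q powi m) / (1 - q)"

definition rcong :: "rfun4 \<Rightarrow> rfun4 \<Rightarrow> mpoly4 \<Rightarrow> bool" where
  "rcong A B P \<longleftrightarrow> (\<exists>F G. G \<noteq> 0 \<and> coprime G P \<and> A - B = emb P * emb F / emb G)"

end

theory Submission
  imports Defs "HOL-Computational_Algebra.Field_as_Ring" "HOL-Number_Theory.Totient"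
begin

text \<open>
Write \<open>D = q\<^sup>d\<close>, \<open>\<alpha> = q\<^sup>r\<close> and \<open>z = q\<^sup>n = \<alpha>D\<^sup>m\<close>. Modulo \<open>1 - az\<close> and \<open>a - z\<close> the parameter \<open>a\<close> may be
replaced by \<open>z\<^sup>-\<^sup>1\<close> or \<open>z\<close>; the left-hand side then terminates and the congruence becomes an
equality, an instance of Watson's transformation. Watson's transformation is obtained by expanding
one quotient of factors by the q-Saalschuetz sum and summing the inner very-well-poised series.

Modulo \<open>\<Phi>\<^sub>n\<^sup>2\<close>, deform one factor \<open>(\<alpha>;D)\<^sub>k / (D;D)\<^sub>k\<close> of the summand to
\<open>b\<^sup>k(\<alpha>/b;D)\<^sub>k / (bD;D)\<^sub>k\<close>. At \<open>b = z\<close> the sum is again given by Watson's transformation and is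
\<open>1 - z\<close> times a factor congruent modulo \<open>\<Phi>\<^sub>n\<close> to the one on the right. Modulo \<open>\<Phi>\<^sub>n\<close> the terms
\<open>k\<close> and \<open>m - k\<close> cancel for every \<open>b\<close>, so the sum over \<open>k\<close> is divisible by \<open>\<Phi>\<^sub>n\<close> as a function of \<open>b\<close>;
since \<open>\<Phi>\<^sub>n\<close> divides \<open>1 - z\<close>, passing from \<open>b = z\<close> to \<open>b = 1\<close> changes it by a multiple of \<open>\<Phi>\<^sub>n\<^sup>2\<close>.
\<close>

section \<open>Summation formulas\<close>

text \<open>\<open>Q_q\<close> is a Chinese-remainder combination. Its quotient (1 - az)(a - z)/(1 -
  a)^2 is 0 modulo the two linear factors and -1 modulo Phi_n, so \<open>Q_q\<close> becomes
  1/(\<alpha>^m (D;D)_m) for the former and (D;D)_m/(\<alpha>^m (D/a, aD;D)_m) for the latter: the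
  constants which the two uses of Watson's transformation produce. The obstacle at Phi_n^2 is that
  the cancellation of k against m - k holds only modulo Phi_n and so supplies one factor. The second
  comes from a difference in b over the increment 1 - z, itself a multiple of Phi_n. The value b = z
  is chosen because \<alpha>/b is then D^-m, so that the series terminates for every a. The power
  b^k restores the very-well-poised argument, which is inversely proportional to the upper
  parameters. No derivative in b is taken: only the values at b = 1 and b = z are compared.
  Reversing the sum does not return the same function of b, but one whose change from b = z to b = 1
  agrees modulo Phi_n^2, which is enough.\<close>

lemma qpoch_0 [simp]: "qpoch x b 0 = 1"
  by (simp add: qpoch_def)

lemma qpoch_Suc: "qpoch x b (Suc m) = qpoch x b m * (1 - x * b ^ m)"
  by (simp add: qpoch_def)

lemma qpoch_rec: "qpoch x b (Suc m) = (1 - x) * qpoch (x * b) b m"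
  by (simp add: qpoch_def prod.lessThan_Suc_shift mult.assoc del: prod.lessThan_Suc)

lemma qpoch_add: "qpoch x b (m + l) = qpoch x b m * qpoch (x * b ^ m) b l"
  by (induction l) (simp_all add: qpoch_Suc power_add mult_ac)

lemma qpoch_nonzero:
  fixes x b :: "'a::field"
  assumes "\<And>i. i < m \<Longrightarrow> x * b ^ i \<noteq> 1" and "k \<le> m"
  shows "qpoch x b k \<noteq> 0"
  using assms by (auto simp: qpoch_def)

lemma qpoch_nonzeroD:
  fixes x b :: "'a::field"
  assumes "qpoch x b m \<noteq> 0" and "k \<le> m"
  shows "qpoch x b k \<noteq> 0"
  using assms by (auto simp: qpoch_def)

text \<open>The sum satisfies a first-order recurrence in the upper summation bound (Zeilberger's
  algorithm); this is the telescoped form of it.\<close>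
lemma saalschuetz_telescope:
  fixes q f \<beta> \<gamma> :: "'a::field"
  assumes q: "q \<noteq> 0"
    and nz: "qpoch q q J \<noteq> 0" "qpoch (f * \<gamma>) q J \<noteq> 0" "qpoch (f * \<beta>) q J \<noteq> 0"
  defines "S \<equiv> \<lambda>k j. qpoch (1 / q ^ k) q j * qpoch (f * \<beta> * \<gamma> / q * q ^ k) q j * qpoch f q j
            / (qpoch q q j * qpoch (f * \<gamma>) q j * qpoch (f * \<beta>) q j) * q ^ j"
  shows "(\<Sum>j\<le>J. (1 - f * \<gamma> * q ^ k) * (1 - f * \<beta> * q ^ k) * S (Suc k) j
            - (1 - \<beta> * q ^ k) * (1 - \<gamma> * q ^ k) * f * S k j)
         = (1 - f * \<beta> * \<gamma> * q ^ (2 * k)) * (qpoch (1 / q ^ k) q J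
            * qpoch (f * \<beta> * \<gamma> * q ^ k) q J * qpoch f q (Suc J)
            / (qpoch q q J * qpoch (f * \<gamma>) q J * qpoch (f * \<beta>) q J))"
  using nz
proof (induction J)
  case 0
  show ?case
    by (simp add: S_def qpoch_def power_mult algebra_simps power2_eq_square)
next
  case (Suc J)
  define x X where "x = q ^ J" and "X = q ^ k"
  define p where "p = qpoch (1 / X) q J"
  define r where "r = qpoch (f * \<beta> * \<gamma> * X) q J"
  define F where "F = qpoch f q (Suc J)"
  define d1 d2 d3 where "d1 = qpoch q q J" and "d2 = qpoch (f * \<gamma>) q J" and "d3 = qpoch (f * \<beta>) q J"
  define e1 e2 e3 where "e1 = 1 - q * x" and "e2 = 1 - f * \<gamma> * x" and "e3 = 1 - f * \<beta> * x"
  have [simp]: "X \<noteq> 0" "x \<noteq> 0" using q by (auto simp: X_def x_def)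
  have nz: "d1 * e1 \<noteq> 0" "d2 * e2 \<noteq> 0" "d3 * e3 \<noteq> 0"
    using Suc.prems by (simp_all add: d1_def e1_def d2_def e2_def d3_def e3_def x_def qpoch_Suc)
  then have nz': "d1 \<noteq> 0" "d2 \<noteq> 0" "d3 \<noteq> 0" "e1 \<noteq> 0" "e2 \<noteq> 0" "e3 \<noteq> 0" by auto
  have S1: "S (Suc k) (Suc J) = ((1 - 1 / (q * X)) * (1 - f * \<beta> * \<gamma> * X * x) * (q * x))
              * (p * r * F / (d1 * e1 * (d2 * e2) * (d3 * e3)))"
  proof -
    have "qpoch (1 / q ^ Suc k) q (Suc J) = (1 - 1 / (q * X)) * p"
      using q by (simp add: qpoch_rec p_def X_def)
    moreover have "qpoch (f * \<beta> * \<gamma> / q * q ^ Suc k) q (Suc J) = r * (1 - f * \<beta> * \<gamma> * X * x)"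
      using q by (simp add: qpoch_Suc r_def X_def x_def mult_ac)
    ultimately show ?thesis
      by (simp add: S_def F_def d1_def d2_def d3_def e1_def e2_def e3_def x_def qpoch_Suc mult_ac)
  qed
  have S2: "S k (Suc J) = ((1 - x / X) * (1 - f * \<beta> * \<gamma> / q * X) * (q * x))
              * (p * r * F / (d1 * e1 * (d2 * e2) * (d3 * e3)))"
  proof -
    have "qpoch (1 / q ^ k) q (Suc J) = p * (1 - x / X)"
      by (simp add: qpoch_Suc p_def X_def x_def)
    moreover have "qpoch (f * \<beta> * \<gamma> / q * q ^ k) q (Suc J) = (1 - f * \<beta> * \<gamma> / q * X) * r"
      using q by (simp add: qpoch_rec r_def X_def)
    ultimately show ?thesis
      by (simp add: S_def F_def d1_def d2_def d3_def e1_def e2_def e3_def x_def qpoch_Suc mult_ac)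
  qed
  have G1: "p * r * F / (d1 * d2 * d3) = p * r * F * (e1 * e2 * e3) / (d1 * e1 * (d2 * e2) * (d3 * e3))"
    using nz' by (simp add: field_simps)
  \<comment> \<open>All terms share the factor p*r*F/?D. Dividing it out leaves an identity of
    rational functions in X = \<open>q ^ k\<close> and x = \<open>q ^ J\<close>.\<close>
  have core: "(1 - f * \<gamma> * X) * (1 - f * \<beta> * X) * ((1 - 1 / (q * X)) * (1 - f * \<beta> * \<gamma> * X * x) * (q * x))
       - (1 - \<beta> * X) * (1 - \<gamma> * X) * f * ((1 - x / X) * (1 - f * \<beta> * \<gamma> / q * X) * (q * x))
      = (1 - f * \<beta> * \<gamma> * X\<^sup>2) * ((1 - x / X) * (1 - f * \<beta> * \<gamma> * X * x) * (1 - f * (q * x)) - e1 * e2 * e3)"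
    using q unfolding e1_def e2_def e3_def by (simp add: field_simps) (simp add: algebra_simps power2_eq_square)
  let ?D = "d1 * e1 * (d2 * e2) * (d3 * e3)"
  have collect: "c * (P * e / D) + (c1 * (s1 * (P / D)) - c2 * (s2 * (P / D)))
      = c * e * (P / D) + (c1 * s1 - c2 * s2) * (P / D)" for c P e D c1 s1 c2 s2 :: 'a
    by (simp add: algebra_simps)
  have "(\<Sum>j\<le>Suc J. (1 - f * \<gamma> * q ^ k) * (1 - f * \<beta> * q ^ k) * S (Suc k) j
            - (1 - \<beta> * q ^ k) * (1 - \<gamma> * q ^ k) * f * S k j)
     = (1 - f * \<beta> * \<gamma> * X\<^sup>2) * (p * r * F / (d1 * d2 * d3))
       + ((1 - f * \<gamma> * X) * (1 - f * \<beta> * X) * S (Suc k) (Suc J)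
            - (1 - \<beta> * X) * (1 - \<gamma> * X) * f * S k (Suc J))"
    using Suc.IH nz' by (simp add: X_def d1_def d2_def d3_def p_def r_def F_def power_mult mult.commute
        flip: power_mult)
  also have "\<dots> = (1 - f * \<beta> * \<gamma> * X\<^sup>2) * (e1 * e2 * e3) * (p * r * F / ?D)
      + ((1 - f * \<gamma> * X) * (1 - f * \<beta> * X) * ((1 - 1 / (q * X)) * (1 - f * \<beta> * \<gamma> * X * x) * (q * x))
       - (1 - \<beta> * X) * (1 - \<gamma> * X) * f * ((1 - x / X) * (1 - f * \<beta> * \<gamma> / q * X) * (q * x))) * (p * r * F / ?D)"
    unfolding S1 S2 G1 by (rule collect)
  also have "\<dots> = (1 - f * \<beta> * \<gamma> * X\<^sup>2) * ((1 - x / X) * (1 - f * \<beta> * \<gamma> * X * x) * (1 - f * (q * x))) * (p * r * F / ?D)"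
    unfolding core right_diff_distrib[of _ _ "e1 * e2 * e3"] by (simp add: algebra_simps)
  also have "\<dots> = (1 - f * \<beta> * \<gamma> * q ^ (2 * k)) * (qpoch (1 / q ^ k) q (Suc J)
            * qpoch (f * \<beta> * \<gamma> * q ^ k) q (Suc J) * qpoch f q (Suc (Suc J))
            / (qpoch q q (Suc J) * qpoch (f * \<gamma>) q (Suc J) * qpoch (f * \<beta>) q (Suc J)))"
    by (simp add: qpoch_Suc[of _ _ J] qpoch_Suc[of _ _ "Suc J"] X_def d1_def d2_def d3_def p_def r_def F_def
       e1_def e2_def e3_def x_def power_mult mult_ac flip: power_mult)
  finally show ?case .
qed

text \<open>Balanced 3phi2 sum. For \<alpha>q = f\<beta>\<gamma> the parameters
  \<open>f * \<gamma>\<close> and \<open>f * \<beta>\<close> are \<alpha>q/\<beta> and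
  \<alpha>q/\<gamma>, the lower parameters of a well-poised series. Induction on k: for J = k + 1
  the telescoped side contains (q^-k;q)_{k+1} = 0, which leaves the two-term recurrence of the
  product.\<close>

lemma q_saalschuetz:
  fixes q f \<beta> \<gamma> :: "'a::field"
  assumes q: "q \<noteq> 0"
    and nz: "qpoch q q k \<noteq> 0" "qpoch (f * \<gamma>) q k \<noteq> 0" "qpoch (f * \<beta>) q k \<noteq> 0"
  shows "(\<Sum>j\<le>k. qpoch (1 / q ^ k) q j * qpoch (f * \<beta> * \<gamma> / q * q ^ k) q j * qpoch f q j
            / (qpoch q q j * qpoch (f * \<gamma>) q j * qpoch (f * \<beta>) q j) * q ^ j)
         = qpoch \<beta> q k * qpoch \<gamma> q k / (qpoch (f * \<gamma>) q k * qpoch (f * \<beta>) q k) * f ^ k"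
  using nz
proof (induction k)
  case 0
  show ?case by simp
next
  case (Suc k)
  define S where "S = (\<lambda>k j. qpoch (1 / q ^ k) q j * qpoch (f * \<beta> * \<gamma> / q * q ^ k) q j * qpoch f q j
            / (qpoch q q j * qpoch (f * \<gamma>) q j * qpoch (f * \<beta>) q j) * q ^ j)"
  have vanish: "qpoch (1 / q ^ k) q (Suc k) = 0"
    using q by (simp add: qpoch_Suc)
  have "(\<Sum>j\<le>Suc k. (1 - f * \<gamma> * q ^ k) * (1 - f * \<beta> * q ^ k) * S (Suc k) j
            - (1 - \<beta> * q ^ k) * (1 - \<gamma> * q ^ k) * f * S k j) = 0"
    unfolding S_def by (subst saalschuetz_telescope[OF q Suc.prems]) (simp add: vanish)
  moreover have "(\<Sum>j\<le>Suc k. S k j) = (\<Sum>j\<le>k. S k j)"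
    by (simp add: S_def vanish)
  ultimately have "(1 - f * \<gamma> * q ^ k) * (1 - f * \<beta> * q ^ k) * (\<Sum>j\<le>Suc k. S (Suc k) j)
      = (1 - \<beta> * q ^ k) * (1 - \<gamma> * q ^ k) * f * (\<Sum>j\<le>k. S k j)"
    by (simp add: sum_subtractf flip: sum_distrib_left del: sum.atMost_Suc)
  also have "(\<Sum>j\<le>k. S k j) = qpoch \<beta> q k * qpoch \<gamma> q k / (qpoch (f * \<gamma>) q k * qpoch (f * \<beta>) q k) * f ^ k"
    unfolding S_def using Suc.prems by (intro Suc.IH) (auto simp: qpoch_Suc)
  finally have "(\<Sum>j\<le>Suc k. S (Suc k) j) = (1 - \<beta> * q ^ k) * (1 - \<gamma> * q ^ k) * f
      * (qpoch \<beta> q k * qpoch \<gamma> q k / (qpoch (f * \<gamma>) q k * qpoch (f * \<beta>) q k) * f ^ k)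
      / ((1 - f * \<gamma> * q ^ k) * (1 - f * \<beta> * q ^ k))"
    using Suc.prems by (subst eq_divide_eq) (auto simp: qpoch_Suc mult_ac simp del: sum.atMost_Suc)
  then show ?case
    unfolding S_def by (simp add: qpoch_Suc mult_ac del: sum.atMost_Suc)
qed

text \<open>Equals x^l (1/x;q)_l, see \<open>fallp_conv_qpoch\<close>. At x = q^N it is the
  terminating factor (q^-N;q)_l together with the power q^(N l) of the series argument, free of
  inverse powers.\<close>

definition fallp :: "'a::comm_ring_1 \<Rightarrow> 'a \<Rightarrow> nat \<Rightarrow> 'a" where
  "fallp q x l = (\<Prod>i<l. x - q ^ i)"

lemma fallp_0 [simp]: "fallp q x 0 = 1"
  by (simp add: fallp_def)

lemma fallp_Suc: "fallp q x (Suc l) = fallp q x l * (x - q ^ l)"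
  by (simp add: fallp_def)

lemma fallp_Suc': "fallp q (q * x) (Suc l) = (q * x - 1) * q ^ l * fallp q x l"
proof -
  have "fallp q (q * x) (Suc l) = (q * x - 1) * (\<Prod>i<l. q * (x - q ^ i))"
    unfolding fallp_def by (simp add: prod.lessThan_Suc_shift algebra_simps del: prod.lessThan_Suc)
  then show ?thesis by (simp add: fallp_def prod.distrib)
qed

lemma fallp_eq_0: "N < l \<Longrightarrow> fallp q (q ^ N) l = 0"
  unfolding fallp_def by (intro prod_zero) auto

text \<open>Telescoped form of a first-order recurrence in N for the terminating very-well-poised
  6phi5 series. With A q = l B C the lower parameters A q/B and A q/C are \<open>l * C\<close> and
  \<open>l * B\<close>, and the argument is l once q^(N j) sits in \<open>fallp\<close>. The usual
  division by 1 - A is omitted, so A = 1 needs no exception.\<close>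

lemma phi65_telescope:
  fixes q l B C :: "'a::field"
  assumes q: "q \<noteq> 0"
    and nz: "qpoch q q J \<noteq> 0" "qpoch (l * C) q J \<noteq> 0" "qpoch (l * B) q J \<noteq> 0"
      "qpoch (l * B * C * q ^ N) q (Suc J) \<noteq> 0"
  defines "A \<equiv> l * B * C / q"
  defines "S \<equiv> \<lambda>N j. (1 - A * q ^ (2 * j)) * (qpoch A q j * qpoch B q j * qpoch C q j * fallp q (q ^ N) j
            / (qpoch q q j * qpoch (l * C) q j * qpoch (l * B) q j * qpoch (l * B * C * q ^ N) q j)) * l ^ j"
  shows "(\<Sum>j\<le>J. (1 - l * C * q ^ N) * (1 - l * B * q ^ N) * S (Suc N) j
            - (1 - l * B * C * q ^ N) * (1 - l * q ^ N) * S N j)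
         = q ^ N * (qpoch A q (Suc J) * qpoch B q (Suc J) * qpoch C q (Suc J) * fallp q (q ^ N) J
            / (qpoch q q J * qpoch (l * C) q J * qpoch (l * B) q J * qpoch (l * B * C * q ^ Suc N) q J)) * l ^ Suc J"
  using nz
proof (induction J)
  case 0
  show ?case
    using q by (simp add: S_def A_def qpoch_Suc field_simps)
next
  case (Suc J)
  define x Y where "x = q ^ J" and "Y = q ^ N"
  define u where "u = l * B * C"
  define a where "a = qpoch A q (Suc J)"
  define b where "b = qpoch B q (Suc J)"
  define c where "c = qpoch C q (Suc J)"
  define p where "p = fallp q Y J"
  define d1 d2 d3 d4 where "d1 = qpoch q q J" and "d2 = qpoch (l * C) q J" and "d3 = qpoch (l * B) q J"
    and "d4 = qpoch (u * (q * Y)) q J"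
  define e0 e1 e2 e3 e4 where "e0 = 1 - u * Y" and "e1 = 1 - q * x" and "e2 = 1 - l * C * x"
    and "e3 = 1 - l * B * x" and "e4 = 1 - u * (q * Y) * x"
  have u: "u = q * A" using q by (simp add: u_def A_def)
  have uq: "u * Y * q = u * (q * Y)" by simp
  have "qpoch (u * Y) q (Suc (Suc J)) \<noteq> 0"
    using Suc.prems by (simp add: u_def Y_def)
  then have nz4: "e0 \<noteq> 0" "d4 \<noteq> 0" "e4 \<noteq> 0"
    unfolding qpoch_rec[of "u * Y"] uq qpoch_Suc[of "u * (q * Y)"]
    by (auto simp: e0_def d4_def e4_def x_def)
  have nz': "d1 \<noteq> 0" "d2 \<noteq> 0" "d3 \<noteq> 0" "e1 \<noteq> 0" "e2 \<noteq> 0" "e3 \<noteq> 0"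
    using Suc.prems by (auto simp add: d1_def e1_def d2_def e2_def d3_def e3_def x_def qpoch_Suc)
  let ?D = "d1 * e1 * (d2 * e2) * (d3 * e3) * (d4 * e4)"
  have sq: "q ^ (2 * Suc J) = (q * x)\<^sup>2"
    unfolding x_def power_Suc[symmetric] by (simp only: power_mult[symmetric] mult.commute)
  have S1: "S (Suc N) (Suc J) = (1 - A * (q * x)\<^sup>2) * ((q * Y - 1) * x) * (a * b * c * p * l ^ Suc J / ?D)"
    unfolding S_def sq power_Suc[of q N] fallp_Suc'
    by (simp add: a_def b_def c_def p_def d1_def d2_def d3_def d4_def e1_def e2_def e3_def e4_def
      x_def Y_def u_def qpoch_Suc mult_ac)
  \<comment> \<open>The parameter \<open>l * B * C * q ^ N\<close> moves with N: its factorial for N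
    starts one factor earlier, at e0, and stops before e4. Hence the quotient
    \<open>e4 / e0\<close>.\<close>
  have S2: "S N (Suc J) = (1 - A * (q * x)\<^sup>2) * ((Y - x) * (e4 / e0)) * (a * b * c * p * l ^ Suc J / ?D)"
  proof -
    have "qpoch (l * B * C * q ^ N) q (Suc J) = e0 * d4"
      unfolding d4_def e0_def u_def[symmetric] Y_def[symmetric] qpoch_rec uq ..
    then have "S N (Suc J) = (1 - A * (q * x)\<^sup>2) * (a * b * c * (p * (Y - x)) / (d1 * e1 * (d2 * e2) * (d3 * e3) * (e0 * d4))) * l ^ Suc J"
      unfolding S_def sq
      by (simp add: a_def b_def c_def p_def d1_def d2_def d3_def e1_def e2_def e3_def
        x_def Y_def qpoch_Suc fallp_Suc mult_ac)
    then show ?thesis using nz4 by (simp add: mult_ac)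
  qed
  have G1: "a * b * c * p / (d1 * d2 * d3 * d4) = a * b * c * p * (e1 * e2 * e3 * e4) / ?D"
    using nz' nz4 by (simp add: field_simps)
  have uBC: "A * q = l * B * C" using q by (simp add: A_def)
  have collect: "y * (P * e / D) * L + (c1 * (s1 * (P * L / D)) - z * c2 * (K * (v * (w / z)) * (P * L / D)))
      = y * e * (P * L / D) + (c1 * s1 - c2 * (K * (v * w))) * (P * L / D)"
    if "z \<noteq> 0" for y P e D L c1 s1 z c2 K v w :: 'a
    using that by (simp add: algebra_simps)
  have e4_eq: "e4 = 1 - q * A * (q * Y) * x" by (simp add: e4_def u)
  have core: "(1 - l * C * Y) * (1 - l * B * Y) * ((1 - A * (q * x)\<^sup>2) * ((q * Y - 1) * x))
       - (1 - l * Y) * ((1 - A * (q * x)\<^sup>2) * ((Y - x) * e4))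
      = Y * ((1 - A * (q * x)) * (1 - B * (q * x)) * (1 - C * (q * x)) * (Y - x) * l - e1 * e2 * e3 * e4)"
    using uBC unfolding e1_def e2_def e3_def e4_eq by algebra
  have "(\<Sum>j\<le>Suc J. (1 - l * C * q ^ N) * (1 - l * B * q ^ N) * S (Suc N) j
            - (1 - l * B * C * q ^ N) * (1 - l * q ^ N) * S N j)
     = Y * (a * b * c * p / (d1 * d2 * d3 * d4)) * l ^ Suc J
       + ((1 - l * C * Y) * (1 - l * B * Y) * S (Suc N) (Suc J)
            - e0 * (1 - l * Y) * S N (Suc J))"
  proof -
    have "qpoch (l * B * C * q ^ N) q (Suc J) \<noteq> 0"
      using Suc.prems(4) by (rule qpoch_nonzeroD) simp
    then show ?thesis
      using Suc.IH nz' by (simp add: Y_def u_def d1_def d2_def d3_def d4_def p_def a_def b_def c_def e0_def)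
  qed
  also have "\<dots> = Y * (e1 * e2 * e3 * e4) * (a * b * c * p * l ^ Suc J / ?D)
       + ((1 - l * C * Y) * (1 - l * B * Y) * ((1 - A * (q * x)\<^sup>2) * ((q * Y - 1) * x))
       - (1 - l * Y) * ((1 - A * (q * x)\<^sup>2) * ((Y - x) * e4))) * (a * b * c * p * l ^ Suc J / ?D)"
    unfolding S1 S2 G1 by (rule collect[OF nz4(1)])
  also have "\<dots> = Y * ((1 - A * (q * x)) * (1 - B * (q * x)) * (1 - C * (q * x)) * (Y - x) * l) * (a * b * c * p * l ^ Suc J / ?D)"
    unfolding core right_diff_distrib[of _ _ "e1 * e2 * e3 * e4"] by (simp add: algebra_simps)
  also have "\<dots> = q ^ N * (qpoch A q (Suc (Suc J)) * qpoch B q (Suc (Suc J)) * qpoch C q (Suc (Suc J)) * fallp q (q ^ N) (Suc J)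
            / (qpoch q q (Suc J) * qpoch (l * C) q (Suc J) * qpoch (l * B) q (Suc J) * qpoch (l * B * C * q ^ Suc N) q (Suc J))) * l ^ Suc (Suc J)"
    by (simp add: qpoch_Suc[of _ _ J] qpoch_Suc[of _ _ "Suc J"] fallp_Suc Y_def d1_def d2_def d3_def d4_def p_def
       a_def b_def c_def u_def e1_def e2_def e3_def e4_def x_def mult_ac)
  finally show ?case .
qed

text \<open>Induction on N: the telescoped side at J = N + 1 contains
  \<open>fallp q (q ^ N) (Suc N)\<close>, which is 0. Nonvanishing up to length 2N covers (l B C
  q^M;q)_M for all M \<le> N that the induction passes through.\<close>

lemma phi65_sum:
  fixes q l B C :: "'a::field"
  assumes q: "q \<noteq> 0"
    and nz: "qpoch q q N \<noteq> 0" "qpoch (l * C) q N \<noteq> 0" "qpoch (l * B) q N \<noteq> 0"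
      "qpoch (l * B * C) q (2 * N) \<noteq> 0"
  defines "A \<equiv> l * B * C / q"
  shows "(\<Sum>j\<le>N. (1 - A * q ^ (2 * j)) * (qpoch A q j * qpoch B q j * qpoch C q j * fallp q (q ^ N) j
            / (qpoch q q j * qpoch (l * C) q j * qpoch (l * B) q j * qpoch (l * B * C * q ^ N) q j)) * l ^ j)
         = qpoch A q (Suc N) * qpoch l q N / (qpoch (l * C) q N * qpoch (l * B) q N)"
  using nz
proof (induction N)
  case 0
  show ?case by (simp add: qpoch_Suc)
next
  case (Suc N)
  define S where "S = (\<lambda>N j. (1 - A * q ^ (2 * j)) * (qpoch A q j * qpoch B q j * qpoch C q j * fallp q (q ^ N) j
            / (qpoch q q j * qpoch (l * C) q j * qpoch (l * B) q j * qpoch (l * B * C * q ^ N) q j)) * l ^ j)"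
  have vanish: "fallp q (q ^ N) (Suc N) = 0"
    by (rule fallp_eq_0) simp
  have 2: "2 * Suc N = N + Suc (Suc N)" by simp
  have nz4: "qpoch (l * B * C * q ^ N) q (Suc (Suc N)) \<noteq> 0"
    using Suc.prems(4) unfolding 2 qpoch_add by simp
  have "(\<Sum>j\<le>Suc N. (1 - l * C * q ^ N) * (1 - l * B * q ^ N) * S (Suc N) j
            - (1 - l * B * C * q ^ N) * (1 - l * q ^ N) * S N j) = 0"
    unfolding S_def A_def
    by (subst phi65_telescope[OF q Suc.prems(1-3) nz4]) (simp add: vanish)
  moreover have "(\<Sum>j\<le>Suc N. S N j) = (\<Sum>j\<le>N. S N j)"
    by (simp add: S_def vanish)
  ultimately have "(1 - l * C * q ^ N) * (1 - l * B * q ^ N) * (\<Sum>j\<le>Suc N. S (Suc N) j)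
      = (1 - l * B * C * q ^ N) * (1 - l * q ^ N) * (\<Sum>j\<le>N. S N j)"
    by (simp add: sum_subtractf flip: sum_distrib_left del: sum.atMost_Suc)
  also have "(\<Sum>j\<le>N. S N j) = qpoch A q (Suc N) * qpoch l q N / (qpoch (l * C) q N * qpoch (l * B) q N)"
    unfolding S_def
  proof (rule Suc.IH)
    show "qpoch (l * B * C) q (2 * N) \<noteq> 0"
      using Suc.prems(4) by (rule qpoch_nonzeroD) simp
  qed (use Suc.prems in \<open>auto simp: qpoch_Suc\<close>)
  finally have "(\<Sum>j\<le>Suc N. S (Suc N) j) = (1 - l * B * C * q ^ N) * (1 - l * q ^ N)
      * (qpoch A q (Suc N) * qpoch l q N / (qpoch (l * C) q N * qpoch (l * B) q N))
      / ((1 - l * C * q ^ N) * (1 - l * B * q ^ N))"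
    using Suc.prems by (subst eq_divide_eq) (auto simp: qpoch_Suc mult_ac simp del: sum.atMost_Suc)
  moreover have "A * q ^ Suc N = l * B * C * q ^ N"
    using q by (simp add: A_def)
  then have "qpoch A q (Suc (Suc N)) = qpoch A q (Suc N) * (1 - l * B * C * q ^ N)"
    unfolding qpoch_Suc[of _ _ "Suc N"] by simp
  ultimately show ?case
    unfolding S_def by (simp add: qpoch_Suc[of _ _ N] mult_ac del: sum.atMost_Suc)
qed

section \<open>Watson's transformation\<close>

definition tri :: "'a::comm_ring_1 \<Rightarrow> nat \<Rightarrow> 'a" where
  "tri q m = (\<Prod>i<m. q ^ i)"

lemma tri_0 [simp]: "tri q 0 = 1"
  by (simp add: tri_def)

lemma tri_Suc: "tri q (Suc m) = tri q m * q ^ m"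
  by (simp add: tri_def)

lemma tri_nonzero: "q \<noteq> 0 \<Longrightarrow> tri q m \<noteq> 0" for q :: "'a::field"
  by (simp add: tri_def)

lemma tri_add: "tri q (m + l) = tri q m * tri q l * q ^ (m * l)"
  by (induction l) (simp_all add: tri_Suc power_add mult_ac)

text \<open>\<open>tri q j\<close> is q to the binomial coefficient j over 2, and j^2 is twice that
  coefficient plus j.\<close>

lemma tri_square: "q ^ (j * j) = tri q j * tri q j * q ^ j"
  by (induction j) (simp_all add: tri_Suc power_add mult_ac)

lemma fallp_add: "j \<le> N \<Longrightarrow> fallp q (q ^ N) (j + l) = fallp q (q ^ N) j * q ^ (j * l) * fallp q (q ^ (N - j)) l"
proof (induction l)
  case (Suc l)
  have "q ^ N = q ^ j * q ^ (N - j)"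
    using Suc.prems by (simp flip: power_add)
  then have "q ^ N - q ^ (j + l) = q ^ j * (q ^ (N - j) - q ^ l)"
    by (simp add: power_add algebra_simps)
  with Suc show ?case
    by (simp add: fallp_Suc power_add mult_ac)
qed simp

lemma fallp_conv_qpoch:
  fixes q x :: "'a::field"
  shows "x \<noteq> 0 \<Longrightarrow> fallp q x j = x ^ j * qpoch (1 / x) q j"
  by (induction j) (simp_all add: fallp_Suc qpoch_Suc field_simps)

lemma qpoch_neg_power:
  fixes q :: "'a::field"
  assumes "q \<noteq> 0"
  shows "qpoch (1 / q ^ (j + l)) q j * qpoch q q l * q ^ (j * l) * q ^ j * tri q j
         = (- 1) ^ j * qpoch q q (j + l)"
proof (induction j)
  case (Suc j)
  have "qpoch (1 / q ^ (Suc j + l)) q (Suc j) = (1 - 1 / (q * q ^ j * q ^ l)) * qpoch (1 / q ^ (j + l)) q j"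
    using assms by (simp add: qpoch_rec power_add)
  moreover have "(1 - 1 / (q * q ^ j * q ^ l)) * (q * q ^ j * q ^ l) = - (1 - q * q ^ (j + l))"
    using assms by (simp add: field_simps power_add)
  ultimately have "qpoch (1 / q ^ (Suc j + l)) q (Suc j) * qpoch q q l * q ^ (Suc j * l) * q ^ Suc j * tri q (Suc j)
      = - (1 - q * q ^ (j + l)) * (qpoch (1 / q ^ (j + l)) q j * qpoch q q l * q ^ (j * l) * q ^ j * tri q j)"
    by (simp add: tri_Suc power_add mult_ac)
  also have "\<dots> = (- 1) ^ Suc j * qpoch q q (Suc j + l)"
    unfolding Suc.IH by (simp add: qpoch_Suc algebra_simps)
  finally show ?case .
qed simp

text \<open>Each factor is turned around, 1 - l q^i = -l q^i (1 - q^-i/l), and the product is read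
  backwards.\<close>

lemma qpoch_reverse_neg:
  fixes q l :: "'a::field"
  assumes "q \<noteq> 0" "l \<noteq> 0"
  shows "qpoch (q / (l * q ^ N)) q N * ((- l) ^ N * tri q N) = qpoch l q N"
proof (induction N)
  case (Suc N)
  have "qpoch (q / (l * q ^ Suc N)) q (Suc N) = (1 - 1 / (l * q ^ N)) * qpoch (q / (l * q ^ N)) q N"
    using assms by (simp add: qpoch_rec)
  then have "qpoch (q / (l * q ^ Suc N)) q (Suc N) * ((- l) ^ Suc N * tri q (Suc N))
      = ((1 - 1 / (l * q ^ N)) * (- l * q ^ N)) * (qpoch (q / (l * q ^ N)) q N * ((- l) ^ N * tri q N))"
    by (simp only: tri_Suc power_Suc mult_ac)
  also have "(1 - 1 / (l * q ^ N)) * (- l * q ^ N) = 1 - l * q ^ N"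
    using assms by (simp add: field_simps)
  finally show ?case
    unfolding Suc.IH by (simp only: qpoch_Suc mult.commute)
qed simp

text \<open>After k = j + i this is a 6phi5 series in i with A = \<alpha>q^(2j), B = \<delta>q^j, C
  = \<epsilon>q^j, the same l, and N = m - j. The weight (q^-k, \<alpha>q^k;q)_j is what the
  q-Saalschuetz expansion contributes to the double sum.\<close>

lemma watson_inner:
  fixes q \<alpha> l \<delta> \<epsilon> :: "'a::field"
  assumes q: "q \<noteq> 0" and \<alpha>: "\<alpha> * q = l * \<delta> * \<epsilon>" and jm: "j \<le> m"
    and nz: "qpoch q q m \<noteq> 0" "qpoch (l * \<epsilon>) q m \<noteq> 0" "qpoch (l * \<delta>) q m \<noteq> 0"
      "qpoch (\<alpha> * q) q (2 * m) \<noteq> 0"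
  shows "(\<Sum>k=j..m. (1 - \<alpha> * q ^ (2 * k)) * (qpoch \<alpha> q k * qpoch \<delta> q k * qpoch \<epsilon> q k * fallp q (q ^ m) k
            / (qpoch q q k * qpoch (l * \<epsilon>) q k * qpoch (l * \<delta>) q k * qpoch (\<alpha> * q * q ^ m) q k)) * l ^ k
            * (qpoch (1 / q ^ k) q j * qpoch (\<alpha> * q ^ k) q j))
         = qpoch \<alpha> q (Suc m) / (qpoch (l * \<epsilon>) q m * qpoch (l * \<delta>) q m)
           * (qpoch \<delta> q j * qpoch \<epsilon> q j * fallp q (q ^ m) j * qpoch l q (m - j) * (- l) ^ j / (tri q j * q ^ j))"
    (is "sum ?T _ = _")
proof -
  define N A B C where "N = m - j" and "A = \<alpha> * q ^ (2 * j)" and "B = \<delta> * q ^ j" and "C = \<epsilon> * q ^ j"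
  have m: "m = j + N" using jm by (simp add: N_def)
  have lBC: "l * B * C = \<alpha> * q * q ^ (2 * j)"
    unfolding \<alpha> B_def C_def mult_2 power_add by (simp only: mult_ac)
  have A: "A = l * B * C / q"
    using q by (simp add: lBC A_def)
  have nzm: "qpoch q q (j + N) \<noteq> 0" "qpoch (l * \<epsilon>) q (j + N) \<noteq> 0" "qpoch (l * \<delta>) q (j + N) \<noteq> 0"
    "qpoch (\<alpha> * q) q (2 * j + 2 * N) \<noteq> 0"
    using nz unfolding m by (simp_all add: distrib_left)
  have nzN: "qpoch q q N \<noteq> 0" "qpoch (l * C) q N \<noteq> 0" "qpoch (l * B) q N \<noteq> 0" "qpoch (l * B * C) q (2 * N) \<noteq> 0"
  proof -
    show "qpoch q q N \<noteq> 0" using nzm(1) by (rule qpoch_nonzeroD) simp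
    show "qpoch (l * C) q N \<noteq> 0" "qpoch (l * B) q N \<noteq> 0"
      using nzm(2,3) unfolding qpoch_add by (auto simp: B_def C_def mult.assoc)
    show "qpoch (l * B * C) q (2 * N) \<noteq> 0"
      using nzm(4) unfolding qpoch_add lBC by simp
  qed
  have nzj: "qpoch (l * \<epsilon>) q j \<noteq> 0" "qpoch (l * \<delta>) q j \<noteq> 0"
    using nzm(2,3) by (auto elim!: qpoch_nonzeroD)
  have nza: "qpoch (\<alpha> * q * q ^ m) q j \<noteq> 0"
  proof -
    have "qpoch (\<alpha> * q) q (m + j) \<noteq> 0"
      using nz(4) by (rule qpoch_nonzeroD) (use jm in simp)
    then show ?thesis unfolding qpoch_add by simp
  qed
  define cst where "cst = qpoch \<alpha> q (2 * j) * qpoch \<delta> q j * qpoch \<epsilon> q j * fallp q (q ^ m) j * (- l) ^ j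
     / (qpoch (l * \<epsilon>) q j * qpoch (l * \<delta>) q j * qpoch (\<alpha> * q * q ^ m) q j * (tri q j * q ^ j))"
  have term_eq: "?T (j + i) = cst * ((1 - A * q ^ (2 * i)) * (qpoch A q i * qpoch B q i * qpoch C q i * fallp q (q ^ N) i
            / (qpoch q q i * qpoch (l * C) q i * qpoch (l * B) q i * qpoch (l * B * C * q ^ N) q i)) * l ^ i)"
    if "i \<le> N" for i
  proof -
    have "qpoch q q i \<noteq> 0" "qpoch q q (j + i) \<noteq> 0"
      using nzm(1) that by (auto elim!: qpoch_nonzeroD)
    \<comment> \<open>Here (q^-k;q)_j turns 1/(q;q)_k into 1/(q;q)_i up to sign and powers of q. In
      \<open>aa\<close>, (\<alpha>q^k;q)_j prolongs (\<alpha>;q)_k, so that the remaining factorial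
      starts at \<alpha>q^(2j).\<close>
    then have ratio: "qpoch (1 / q ^ (j + i)) q j / qpoch q q (j + i)
        = (- 1) ^ j / (qpoch q q i * (q ^ (j * i) * (tri q j * q ^ j)))"
      using qpoch_neg_power[OF q, of j i] q tri_nonzero[OF q, of j]
      by (simp add: frac_eq_eq mult_ac)
    have aa: "qpoch \<alpha> q (j + i) * qpoch (\<alpha> * q ^ (j + i)) q j = qpoch \<alpha> q (2 * j) * qpoch A q i"
    proof -
      have "qpoch \<alpha> q ((j + i) + j) = qpoch \<alpha> q (2 * j + i)" by (simp add: mult_2 add_ac)
      then show ?thesis unfolding qpoch_add[of _ _ "j + i"] qpoch_add[of _ _ "2 * j"] A_def .
    qed
    have e: "qpoch (\<alpha> * q * q ^ m) q (j + i) = qpoch (\<alpha> * q * q ^ m) q j * qpoch (l * B * C * q ^ N) q i"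
      unfolding qpoch_add lBC m mult_2 power_add by (simp only: mult_ac)
    have fl: "fallp q (q ^ m) (j + i) = fallp q (q ^ m) j * q ^ (j * i) * fallp q (q ^ N) i"
      unfolding N_def by (rule fallp_add[OF jm])
    have A2: "\<alpha> * q ^ (2 * (j + i)) = A * q ^ (2 * i)"
      by (simp add: A_def distrib_left power_add)
    have "?T (j + i) = (1 - A * q ^ (2 * i)) * (qpoch \<alpha> q (j + i) * qpoch (\<alpha> * q ^ (j + i)) q j)
        * (qpoch (1 / q ^ (j + i)) q j / qpoch q q (j + i))
        * (qpoch \<delta> q (j + i) * qpoch \<epsilon> q (j + i) * fallp q (q ^ m) (j + i)
            / (qpoch (l * \<epsilon>) q (j + i) * qpoch (l * \<delta>) q (j + i) * qpoch (\<alpha> * q * q ^ m) q (j + i))) * l ^ (j + i)"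
      unfolding A2 by (simp add: mult_ac)
    also have "\<dots> = (1 - A * q ^ (2 * i)) * (qpoch \<alpha> q (2 * j) * qpoch A q i)
        * ((- 1) ^ j / (qpoch q q i * (q ^ (j * i) * (tri q j * q ^ j))))
        * ((qpoch \<delta> q j * qpoch B q i) * (qpoch \<epsilon> q j * qpoch C q i) * (fallp q (q ^ m) j * q ^ (j * i) * fallp q (q ^ N) i)
            / ((qpoch (l * \<epsilon>) q j * qpoch (l * C) q i) * (qpoch (l * \<delta>) q j * qpoch (l * B) q i)
               * (qpoch (\<alpha> * q * q ^ m) q j * qpoch (l * B * C * q ^ N) q i))) * (l ^ j * l ^ i)"
      unfolding aa ratio e fl
      by (simp only: qpoch_add[of \<delta>] qpoch_add[of \<epsilon>] qpoch_add[of "l * \<epsilon>"] qpoch_add[of "l * \<delta>"]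
          B_def C_def power_add[of l] mult.assoc)
    also have "\<dots> = cst * ((1 - A * q ^ (2 * i)) * (qpoch A q i * qpoch B q i * qpoch C q i * fallp q (q ^ N) i
            / (qpoch q q i * qpoch (l * C) q i * qpoch (l * B) q i * qpoch (l * B * C * q ^ N) q i)) * l ^ i)"
      unfolding cst_def power_minus[of l j] using q by (simp add: mult_ac)
    finally show ?thesis .
  qed
  have "sum ?T {j..m} = (\<Sum>i\<le>N. ?T (j + i))"
    using sum.shift_bounds_cl_nat_ivl[of ?T 0 j N] by (simp add: m add.commute atMost_atLeast0)
  also have "\<dots> = cst * (qpoch A q (Suc N) * qpoch l q N / (qpoch (l * C) q N * qpoch (l * B) q N))"
  proof -
    have "(\<Sum>i\<le>N. ?T (j + i)) = (\<Sum>i\<le>N. cst * ((1 - A * q ^ (2 * i)) * (qpoch A q i * qpoch B q i * qpoch C q i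
        * fallp q (q ^ N) i / (qpoch q q i * qpoch (l * C) q i * qpoch (l * B) q i * qpoch (l * B * C * q ^ N) q i)) * l ^ i))"
      by (intro sum.cong refl term_eq) simp
    then show ?thesis
      by (simp only: sum_distrib_left[symmetric] A phi65_sum[OF q nzN])
  qed
  also have "\<dots> = qpoch \<alpha> q (Suc m) / (qpoch (l * \<epsilon>) q m * qpoch (l * \<delta>) q m)
           * (qpoch \<delta> q j * qpoch \<epsilon> q j * fallp q (q ^ m) j * qpoch l q (m - j) * (- l) ^ j / (tri q j * q ^ j))"
  proof -
    \<comment> \<open>The same factorial is split after 2j and after m + 1. The tail
      (\<alpha>q^(m+1);q)_j of the second splitting cancels a denominator of
      \<open>cst\<close>.\<close>
    have "qpoch \<alpha> q (2 * j + Suc N) = qpoch \<alpha> q (Suc m + j)" by (simp add: m mult_2 add_ac)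
    then have "qpoch \<alpha> q (2 * j) * qpoch A q (Suc N) = qpoch \<alpha> q (Suc m) * qpoch (\<alpha> * q * q ^ m) q j"
      unfolding qpoch_add by (simp add: A_def mult_ac)
    moreover have "qpoch (l * \<epsilon>) q m = qpoch (l * \<epsilon>) q j * qpoch (l * C) q N"
      "qpoch (l * \<delta>) q m = qpoch (l * \<delta>) q j * qpoch (l * B) q N"
      unfolding m qpoch_add B_def C_def by (simp_all only: mult.assoc)
    moreover define R where "R = qpoch \<delta> q j * qpoch \<epsilon> q j * fallp q (q ^ m) j * qpoch l q N * (- l) ^ j / (tri q j * q ^ j)"
    moreover have "cst * (qpoch A q (Suc N) * qpoch l q N / (qpoch (l * C) q N * qpoch (l * B) q N))
       = (qpoch \<alpha> q (2 * j) * qpoch A q (Suc N)) * R / (qpoch (l * \<epsilon>) q j * qpoch (l * C) q N * (qpoch (l * \<delta>) q j * qpoch (l * B) q N)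
         * qpoch (\<alpha> * q * q ^ m) q j)"
      by (simp add: cst_def R_def mult_ac)
    ultimately show ?thesis
      using nza by (simp add: N_def mult_ac)
  qed
  finally show ?thesis .
qed

text \<open>Watson's transformation of a terminating very-well-poised series, with
  \<open>f = \<alpha>q/(\<beta>\<gamma>)\<close> and \<open>l = \<alpha>q/(\<delta>\<epsilon>)\<close>. The right-hand side is scaled so that the lower parameter
  \<open>\<delta>\<epsilon>q\<^sup>-\<^sup>m/\<alpha>\<close> of the balanced series appears in a numerator: it may be a negative power of q.\<close>
theorem watson:
  fixes q \<alpha> \<beta> \<gamma> \<delta> \<epsilon> f l :: "'a::field"
  assumes q: "q \<noteq> 0" and l: "l \<noteq> 0" and \<alpha>1: "\<alpha> * q = f * \<beta> * \<gamma>" and \<alpha>2: "\<alpha> * q = l * \<delta> * \<epsilon>"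
    and nz: "qpoch q q m \<noteq> 0" "qpoch (f * \<gamma>) q m \<noteq> 0" "qpoch (f * \<beta>) q m \<noteq> 0"
      "qpoch (l * \<epsilon>) q m \<noteq> 0" "qpoch (l * \<delta>) q m \<noteq> 0" "qpoch (\<alpha> * q) q (2 * m) \<noteq> 0"
  shows "(\<Sum>k\<le>m. (1 - \<alpha> * q ^ (2 * k))
            * (qpoch \<alpha> q k * qpoch \<beta> q k * qpoch \<gamma> q k * qpoch \<delta> q k * qpoch \<epsilon> q k * fallp q (q ^ m) k
              / (qpoch q q k * qpoch (f * \<gamma>) q k * qpoch (f * \<beta>) q k
                * qpoch (l * \<epsilon>) q k * qpoch (l * \<delta>) q k * qpoch (\<alpha> * q * q ^ m) q k)) * (f * l) ^ k)
         = qpoch \<alpha> q (Suc m) * ((- l) ^ m * tri q m) / (qpoch (l * \<epsilon>) q m * qpoch (l * \<delta>) q m)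
           * (\<Sum>j\<le>m. qpoch (q / (l * q ^ (m - j))) q (m - j)
              * (qpoch f q j * qpoch \<delta> q j * qpoch \<epsilon> q j * qpoch (1 / q ^ m) q j)
              / (qpoch q q j * qpoch (f * \<gamma>) q j * qpoch (f * \<beta>) q j) * q ^ j)"
    (is "sum ?T _ = ?c * _")
proof -
  define w where "w k = (1 - \<alpha> * q ^ (2 * k)) * (qpoch \<alpha> q k * qpoch \<delta> q k * qpoch \<epsilon> q k * fallp q (q ^ m) k
            / (qpoch q q k * qpoch (l * \<epsilon>) q k * qpoch (l * \<delta>) q k * qpoch (\<alpha> * q * q ^ m) q k)) * l ^ k" for k
  define v where "v j = qpoch f q j / (qpoch q q j * qpoch (f * \<gamma>) q j * qpoch (f * \<beta>) q j) * q ^ j" for j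
  define g where "g k j = w k * (qpoch (1 / q ^ k) q j * qpoch (\<alpha> * q ^ k) q j)" for k j
  have \<alpha>: "f * \<beta> * \<gamma> / q = \<alpha>" using q \<alpha>1 by (simp add: field_simps)
  have "?T k = (\<Sum>j\<le>k. v j * g k j)" if "k \<le> m" for k
  proof -
    have "qpoch q q k \<noteq> 0" "qpoch (f * \<gamma>) q k \<noteq> 0" "qpoch (f * \<beta>) q k \<noteq> 0"
      using nz that by (auto elim!: qpoch_nonzeroD)
    \<comment> \<open>The factors with \<beta> and \<gamma>, together with f^k, form the quotient
      that is expanded; \<open>w\<close> keeps the rest of the summand.\<close>
    from q_saalschuetz[OF q this]
    have "w k * (\<Sum>j\<le>k. qpoch (1 / q ^ k) q j * qpoch (\<alpha> * q ^ k) q j * qpoch f q j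
            / (qpoch q q j * qpoch (f * \<gamma>) q j * qpoch (f * \<beta>) q j) * q ^ j) = ?T k"
      unfolding \<alpha> by (simp add: w_def power_mult_distrib mult_ac)
    then show ?thesis
      by (simp add: sum_distrib_left g_def v_def mult_ac)
  qed
  then have "sum ?T {..m} = (\<Sum>k\<le>m. \<Sum>j\<le>k. v j * g k j)"
    by (intro sum.cong) auto
  also have "\<dots> = (\<Sum>j\<le>m. \<Sum>k=j..m. v j * g k j)"
    using sum.swap_restrict[of "{..m}" "{..m}" "\<lambda>k j. v j * g k j" "\<lambda>k j. j \<le> k"]
    by (simp add: atLeastAtMost_def atLeast_def atMost_def Int_def conj_commute cong: conj_cong)
  also have "\<dots> = (\<Sum>j\<le>m. ?c * (qpoch (q / (l * q ^ (m - j))) q (m - j)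
              * (qpoch f q j * qpoch \<delta> q j * qpoch \<epsilon> q j * qpoch (1 / q ^ m) q j)
              / (qpoch q q j * qpoch (f * \<gamma>) q j * qpoch (f * \<beta>) q j) * q ^ j))"
  proof (intro sum.cong refl)
    fix j assume "j \<in> {..m}"
    then have jm: "j \<le> m" by simp
    have tri: "tri q (m - j) * q ^ (m * j) = tri q m * (tri q j * q ^ j)"
    proof -
      have "m * j = j * (m - j) + j * j"
        using jm by (simp add: algebra_simps diff_mult_distrib2)
      then have "tri q (m - j) * q ^ (m * j) = (tri q j * tri q (m - j) * q ^ (j * (m - j))) * (tri q j * q ^ j)"
        by (simp add: power_add tri_square mult_ac)
      also have "tri q j * tri q (m - j) * q ^ (j * (m - j)) = tri q m"
        using jm by (simp flip: tri_add)
      finally show ?thesis .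
    qed
    \<comment> \<open>Reversing (l;q)_{m-j} makes the stray powers of l and q independent of j, so
      they leave the sum as (-l)^m \<open>tri q m\<close>.\<close>
    have P: "fallp q (q ^ m) j * qpoch l q (m - j) * (- l) ^ j / (tri q j * q ^ j)
       = (- l) ^ m * tri q m * (qpoch (q / (l * q ^ (m - j))) q (m - j) * qpoch (1 / q ^ m) q j)"
    proof -
      have "fallp q (q ^ m) j * qpoch l q (m - j) * (- l) ^ j
         = ((- l) ^ j * (- l) ^ (m - j)) * (tri q (m - j) * q ^ (m * j))
           * (qpoch (q / (l * q ^ (m - j))) q (m - j) * qpoch (1 / q ^ m) q j)"
        using q by (simp add: fallp_conv_qpoch flip: qpoch_reverse_neg[OF q l, of "m - j"] power_mult)
      also have "(- l) ^ j * (- l) ^ (m - j) = (- l) ^ m"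
        using jm by (simp flip: power_add)
      finally show ?thesis
        unfolding tri using q tri_nonzero[OF q, of j] by simp
    qed
    have "(\<Sum>k=j..m. v j * g k j) = v j * (qpoch \<alpha> q (Suc m) / (qpoch (l * \<epsilon>) q m * qpoch (l * \<delta>) q m)
           * (qpoch \<delta> q j * qpoch \<epsilon> q j * fallp q (q ^ m) j * qpoch l q (m - j) * (- l) ^ j / (tri q j * q ^ j)))"
      by (simp only: g_def w_def sum_distrib_left[symmetric] watson_inner[OF q \<alpha>2 jm nz(1,4-6)])
    also have "\<dots> = v j * (qpoch \<alpha> q (Suc m) / (qpoch (l * \<epsilon>) q m * qpoch (l * \<delta>) q m)
           * (qpoch \<delta> q j * qpoch \<epsilon> q j * (fallp q (q ^ m) j * qpoch l q (m - j) * (- l) ^ j / (tri q j * q ^ j))))"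
      by simp
    finally show "(\<Sum>k=j..m. v j * g k j) = ?c * (qpoch (q / (l * q ^ (m - j))) q (m - j)
              * (qpoch f q j * qpoch \<delta> q j * qpoch \<epsilon> q j * qpoch (1 / q ^ m) q j)
              / (qpoch q q j * qpoch (f * \<gamma>) q j * qpoch (f * \<beta>) q j) * q ^ j)"
      unfolding P v_def by (simp add: mult_ac)
  qed
  finally show ?thesis
    by (simp add: sum_distrib_left)
qed

section \<open>The sums at special parameters\<close>

text \<open>The very-well-poised summand with the second factor \<open>(\<alpha>;D)\<^sub>k / (D;D)\<^sub>k\<close> removed.\<close>
definition vwp :: "'a::field \<Rightarrow> 'a \<Rightarrow> 'a \<Rightarrow> 'a \<Rightarrow> 'a \<Rightarrow> nat \<Rightarrow> 'a" where
  "vwp D \<alpha> a c e k = (1 - \<alpha> * D ^ (2 * k))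
     * (qpoch \<alpha> D k * qpoch (c * \<alpha>) D k * qpoch (e * \<alpha>) D k * qpoch (a * \<alpha>) D k * qpoch (\<alpha> / a) D k
       / (qpoch D D k * qpoch (D / c) D k * qpoch (D / e) D k * qpoch (D / a) D k * qpoch (a * D) D k))
     * (D\<^sup>2 / (\<alpha> ^ 3 * c * e)) ^ k"

text \<open>The sum on the right is the case \<open>z = 1\<close>; the deformed sum leads to \<open>z = q\<^sup>n\<close>.\<close>
definition balsum :: "'a::field \<Rightarrow> 'a \<Rightarrow> 'a \<Rightarrow> 'a \<Rightarrow> 'a \<Rightarrow> nat \<Rightarrow> 'a \<Rightarrow> 'a" where
  "balsum D \<alpha> a c e m z = (\<Sum>k\<le>m. qpoch (\<alpha>\<^sup>2 * D ^ k / z) D (m - k)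
     * (qpoch (D / (\<alpha> * c * e)) D k * qpoch (a * \<alpha>) D k * qpoch (\<alpha> / a) D k * qpoch (\<alpha> / z) D k)
     / (qpoch D D k * qpoch (D / c) D k * qpoch (D / e) D k) * D ^ k)"

lemma vwp_inverse: "a \<noteq> 0 \<Longrightarrow> vwp D \<alpha> (1 / a) c e k = vwp D \<alpha> a c e k"
  by (simp add: vwp_def mult_ac)

lemma balsum_inverse: "a \<noteq> 0 \<Longrightarrow> balsum D \<alpha> (1 / a) c e m z = balsum D \<alpha> a c e m z"
  by (simp add: balsum_def mult_ac)

text \<open>For a = z the upper parameter \<alpha>/a is D^-m, since z = \<alpha>D^m. Watson's
  transformation applies with the pairs c\<alpha>, e\<alpha> and z\<alpha>, \<alpha>, the last
  \<alpha> being the factor left out of \<open>vwp\<close>. The case a = 1/z follows by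
  symmetry.\<close>

lemma vwp_sum_terminating_a:
  fixes D \<alpha> a c e z :: "'a::field"
  assumes nz: "D \<noteq> 0" "\<alpha> \<noteq> 0" "c \<noteq> 0" "e \<noteq> 0" and z: "z = \<alpha> * D ^ m" and a: "a = z \<or> a = 1 / z"
    and nzq: "qpoch D D m \<noteq> 0" "qpoch (D / c) D m \<noteq> 0" "qpoch (D / e) D m \<noteq> 0"
      "qpoch (D / z) D m \<noteq> 0" "qpoch (\<alpha> * D) D (2 * m) \<noteq> 0"
  shows "(\<Sum>k\<le>m. vwp D \<alpha> a c e k * (qpoch \<alpha> D k / qpoch D D k))
         = (1 - z) / (\<alpha> ^ m * qpoch D D m) * balsum D \<alpha> a c e m 1"
proof -
  have z0: "z \<noteq> 0" using nz z by simp
  define f l where "f = D / (\<alpha> * c * e)" and "l = D / (\<alpha> * z)"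
  have f: "f * (e * \<alpha>) = D / c" "f * (c * \<alpha>) = D / e"
    using nz by (simp_all add: f_def)
  have l: "l * (z * \<alpha>) = D" "l * \<alpha> = D / z"
    using nz z0 by (simp_all add: l_def)
  have Dm: "1 / D ^ m = \<alpha> / z" using nz by (simp add: z)
  have summand: "vwp D \<alpha> z c e k * (qpoch \<alpha> D k / qpoch D D k)
     = (1 - \<alpha> * D ^ (2 * k))
            * (qpoch \<alpha> D k * qpoch (c * \<alpha>) D k * qpoch (e * \<alpha>) D k * qpoch (z * \<alpha>) D k * qpoch \<alpha> D k * fallp D (D ^ m) k
              / (qpoch D D k * qpoch (D / c) D k * qpoch (D / e) D k
                * qpoch (D / z) D k * qpoch D D k * qpoch (\<alpha> * D * D ^ m) D k)) * (f * l) ^ k" for k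
  proof -
    have "fallp D (D ^ m) k * (f * l) ^ k = (D ^ m) ^ k * (f * l) ^ k * qpoch (\<alpha> / z) D k"
      using nz by (simp add: fallp_conv_qpoch Dm)
    also have "(D ^ m) ^ k * (f * l) ^ k = (D\<^sup>2 / (\<alpha> ^ 3 * c * e)) ^ k"
      unfolding power_mult_distrib[symmetric]
      using nz by (simp add: f_def l_def z power2_eq_square power3_eq_cube field_simps)
    finally have fl: "fallp D (D ^ m) k * (f * l) ^ k = (D\<^sup>2 / (\<alpha> ^ 3 * c * e)) ^ k * qpoch (\<alpha> / z) D k" .
    have zD: "\<alpha> * D * D ^ m = z * D" by (simp add: z)
    have "(1 - \<alpha> * D ^ (2 * k))
            * (qpoch \<alpha> D k * qpoch (c * \<alpha>) D k * qpoch (e * \<alpha>) D k * qpoch (z * \<alpha>) D k * qpoch \<alpha> D k * fallp D (D ^ m) k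
              / (qpoch D D k * qpoch (D / c) D k * qpoch (D / e) D k
                * qpoch (D / z) D k * qpoch D D k * qpoch (\<alpha> * D * D ^ m) D k)) * (f * l) ^ k
      = (1 - \<alpha> * D ^ (2 * k))
            * (qpoch \<alpha> D k * qpoch (c * \<alpha>) D k * qpoch (e * \<alpha>) D k * qpoch (z * \<alpha>) D k * qpoch \<alpha> D k
              / (qpoch D D k * qpoch (D / c) D k * qpoch (D / e) D k
                * qpoch (D / z) D k * qpoch D D k * qpoch (z * D) D k)) * (fallp D (D ^ m) k * (f * l) ^ k)"
      unfolding zD by simp
    then show ?thesis
      unfolding fl by (simp add: vwp_def mult_ac)
  qed
  have bal: "(\<Sum>j\<le>m. qpoch (D / (l * D ^ (m - j))) D (m - j)
              * (qpoch f D j * qpoch (z * \<alpha>) D j * qpoch \<alpha> D j * qpoch (1 / D ^ m) D j)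
              / (qpoch D D j * qpoch (D / c) D j * qpoch (D / e) D j) * D ^ j) = balsum D \<alpha> z c e m 1"
    unfolding balsum_def
  proof (intro sum.cong refl)
    fix j assume "j \<in> {..m}"
    then have "D ^ m = D ^ (m - j) * D ^ j" by (simp flip: power_add)
    then have arg: "D / (l * D ^ (m - j)) = \<alpha>\<^sup>2 * D ^ j / 1"
      using nz by (simp add: l_def z power2_eq_square)
    show "qpoch (D / (l * D ^ (m - j))) D (m - j)
              * (qpoch f D j * qpoch (z * \<alpha>) D j * qpoch \<alpha> D j * qpoch (1 / D ^ m) D j)
              / (qpoch D D j * qpoch (D / c) D j * qpoch (D / e) D j) * D ^ j
        = qpoch (\<alpha>\<^sup>2 * D ^ j / 1) D (m - j)
             * (qpoch (D / (\<alpha> * c * e)) D j * qpoch (z * \<alpha>) D j * qpoch (\<alpha> / z) D j * qpoch (\<alpha> / 1) D j)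
             / (qpoch D D j * qpoch (D / c) D j * qpoch (D / e) D j) * D ^ j"
      unfolding arg Dm f_def by (simp add: mult_ac)
  qed
  \<comment> \<open>The last factor of (\<alpha>;D)_{m+1} is 1 - z. The others are the reversal of
    (D/z;D)_m and cancel against it.\<close>
  have pre: "qpoch \<alpha> D (Suc m) * ((- l) ^ m * tri D m) / (qpoch (D / z) D m * qpoch D D m)
      = (1 - z) / (\<alpha> ^ m * qpoch D D m)"
  proof -
    have "D / (D / z * D ^ m) = \<alpha>" using nz z0 by (simp add: z)
    then have "qpoch \<alpha> D m * ((- (D / z)) ^ m * tri D m) = qpoch (D / z) D m"
      using qpoch_reverse_neg[of D "D / z" m] nz z0 by simp
    moreover have "(- l) ^ m * \<alpha> ^ m = (- (D / z)) ^ m"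
      unfolding power_mult_distrib[symmetric] l(2)[symmetric] by simp
    ultimately have "qpoch \<alpha> D m * ((- l) ^ m * tri D m) * \<alpha> ^ m = qpoch (D / z) D m"
      by (metis (no_types, lifting) mult.assoc mult.commute)
    then have "qpoch \<alpha> D m * ((- l) ^ m * tri D m) = qpoch (D / z) D m / \<alpha> ^ m"
      using nz by (simp add: eq_divide_eq)
    then have "qpoch \<alpha> D (Suc m) * ((- l) ^ m * tri D m) = (1 - z) * (qpoch (D / z) D m / \<alpha> ^ m)"
      unfolding qpoch_Suc z[symmetric] by (simp only: mult_ac)
    then show ?thesis
      using nzq by simp
  qed
  have "(\<Sum>k\<le>m. vwp D \<alpha> z c e k * (qpoch \<alpha> D k / qpoch D D k))
         = (1 - z) / (\<alpha> ^ m * qpoch D D m) * balsum D \<alpha> z c e m 1"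
    using watson[of D l \<alpha> f "c * \<alpha>" "e * \<alpha>" "z * \<alpha>" \<alpha> m] nz nzq z0
    unfolding f l bal pre summand by (simp add: l_def f_def)
  then show ?thesis
    using a z0 by (auto simp: vwp_inverse balsum_inverse)
qed

text \<open>The product over i < k is z^k (\<alpha>/z;D)_k with \<alpha>/z = D^-m, so here the
  deformed factor terminates the series and a stays free. The second pair in Watson's transformation
  is a\<alpha>, \<alpha>/a, whence l = D/\<alpha>.\<close>

lemma vwp_sum_terminating_b:
  fixes D \<alpha> a c e z :: "'a::field"
  assumes nz: "D \<noteq> 0" "\<alpha> \<noteq> 0" "c \<noteq> 0" "e \<noteq> 0" "a \<noteq> 0" and z: "z = \<alpha> * D ^ m"
    and nzq: "qpoch D D m \<noteq> 0" "qpoch (D / c) D m \<noteq> 0" "qpoch (D / e) D m \<noteq> 0"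
      "qpoch (D / a) D m \<noteq> 0" "qpoch (a * D) D m \<noteq> 0" "qpoch (\<alpha> * D) D (2 * m) \<noteq> 0"
  shows "(\<Sum>k\<le>m. vwp D \<alpha> a c e k * ((\<Prod>i<k. z - \<alpha> * D ^ i) / qpoch (z * D) D k))
         = (1 - z) * (z / \<alpha>) ^ m * qpoch (D / z) D m / (qpoch (D / a) D m * qpoch (a * D) D m)
           * balsum D \<alpha> a c e m z"
proof -
  have z0: "z \<noteq> 0" using nz z by simp
  define f l where "f = D / (\<alpha> * c * e)" and "l = D / \<alpha>"
  have f: "f * (e * \<alpha>) = D / c" "f * (c * \<alpha>) = D / e"
    using nz by (simp_all add: f_def)
  have l: "l * (a * \<alpha>) = a * D" "l * (\<alpha> / a) = D / a"
    using nz z0 by (simp_all add: l_def)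
  have Dm: "1 / D ^ m = \<alpha> / z" using nz by (simp add: z)
  have zD: "\<alpha> * D * D ^ m = z * D" by (simp add: z)
  have summand: "vwp D \<alpha> a c e k * ((\<Prod>i<k. z - \<alpha> * D ^ i) / qpoch (z * D) D k)
     = (1 - \<alpha> * D ^ (2 * k))
            * (qpoch \<alpha> D k * qpoch (c * \<alpha>) D k * qpoch (e * \<alpha>) D k * qpoch (a * \<alpha>) D k * qpoch (\<alpha> / a) D k * fallp D (D ^ m) k
              / (qpoch D D k * qpoch (D / c) D k * qpoch (D / e) D k
                * qpoch (D / a) D k * qpoch (a * D) D k * qpoch (\<alpha> * D * D ^ m) D k)) * (f * l) ^ k" for k
  proof -
    have "(\<Prod>i<k. z - \<alpha> * D ^ i) = (\<Prod>i<k. \<alpha> * (D ^ m - D ^ i))"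
      by (simp add: z algebra_simps)
    also have "\<dots> = \<alpha> ^ k * fallp D (D ^ m) k"
      by (simp add: fallp_def prod.distrib)
    finally have p: "(\<Prod>i<k. z - \<alpha> * D ^ i) = \<alpha> ^ k * fallp D (D ^ m) k" .
    have "f * l = D\<^sup>2 / (\<alpha> ^ 3 * c * e) * \<alpha>"
      using nz by (simp add: f_def l_def power2_eq_square power3_eq_cube)
    then have fl: "(f * l) ^ k = (D\<^sup>2 / (\<alpha> ^ 3 * c * e)) ^ k * \<alpha> ^ k"
      by (metis power_mult_distrib)
    show ?thesis
      unfolding vwp_def p fl zD by (simp add: mult_ac)
  qed
  have bal: "(\<Sum>j\<le>m. qpoch (D / (l * D ^ (m - j))) D (m - j)
              * (qpoch f D j * qpoch (a * \<alpha>) D j * qpoch (\<alpha> / a) D j * qpoch (1 / D ^ m) D j)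
              / (qpoch D D j * qpoch (D / c) D j * qpoch (D / e) D j) * D ^ j) = balsum D \<alpha> a c e m z"
    unfolding balsum_def
  proof (intro sum.cong refl)
    fix j assume "j \<in> {..m}"
    then have "D ^ m = D ^ (m - j) * D ^ j" by (simp flip: power_add)
    then have arg: "D / (l * D ^ (m - j)) = \<alpha>\<^sup>2 * D ^ j / z"
      using nz by (simp add: l_def z power2_eq_square)
    show "qpoch (D / (l * D ^ (m - j))) D (m - j)
              * (qpoch f D j * qpoch (a * \<alpha>) D j * qpoch (\<alpha> / a) D j * qpoch (1 / D ^ m) D j)
              / (qpoch D D j * qpoch (D / c) D j * qpoch (D / e) D j) * D ^ j
        = qpoch (\<alpha>\<^sup>2 * D ^ j / z) D (m - j)
             * (qpoch (D / (\<alpha> * c * e)) D j * qpoch (a * \<alpha>) D j * qpoch (\<alpha> / a) D j * qpoch (\<alpha> / z) D j)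
             / (qpoch D D j * qpoch (D / c) D j * qpoch (D / e) D j) * D ^ j"
      unfolding arg Dm f_def ..
  qed
  have pre: "qpoch \<alpha> D (Suc m) * ((- l) ^ m * tri D m) = (1 - z) * (z / \<alpha>) ^ m * qpoch (D / z) D m"
  proof -
    have "D / (D / z * D ^ m) = \<alpha>" using nz z0 by (simp add: z)
    then have "qpoch (D / z) D m = qpoch \<alpha> D m * ((- (D / z)) ^ m * tri D m)"
      using qpoch_reverse_neg[of D "D / z" m] nz z0 by simp
    moreover have "(- l) ^ m = (z / \<alpha>) ^ m * (- (D / z)) ^ m"
      unfolding power_mult_distrib[symmetric] l_def using z0 by simp
    ultimately show ?thesis
      unfolding qpoch_Suc z[symmetric] by (simp only: mult_ac)
  qed
  show ?thesis
    using watson[of D l \<alpha> f "c * \<alpha>" "e * \<alpha>" "a * \<alpha>" "\<alpha> / a" m] nz nzq z0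
    unfolding f l bal pre summand by (simp add: l_def f_def)
qed

section \<open>Reversing the order of summation\<close>

lemma qpoch_reverse:
  fixes q y :: "'a::field"
  assumes "q \<noteq> 0" "y \<noteq> 0" "k \<le> m"
  shows "qpoch y q (m - k) * qpoch (q / (y * q ^ m)) q k * (- (y * q ^ m / q)) ^ k = qpoch y q m * tri q k"
  using assms(3)
proof (induction k)
  case (Suc k)
  then have m: "m - k = Suc (m - Suc k)" and km: "k \<le> m" by simp_all
  have qm: "q ^ m = q ^ (m - Suc k) * (q * q ^ k)"
    using Suc.prems by (simp flip: power_add power_Suc)
  have factor: "(1 - q / (y * q ^ m) * q ^ k) * (- (y * q ^ m / q)) = (1 - y * q ^ (m - Suc k)) * q ^ k"
    using assms(1,2) unfolding qm by (simp add: field_simps)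
  have "qpoch y q (m - Suc k) * qpoch (q / (y * q ^ m)) q (Suc k) * (- (y * q ^ m / q)) ^ Suc k
    = qpoch y q (m - Suc k) * qpoch (q / (y * q ^ m)) q k * (- (y * q ^ m / q)) ^ k
        * ((1 - q / (y * q ^ m) * q ^ k) * (- (y * q ^ m / q)))"
    unfolding qpoch_Suc power_Suc by (simp only: mult_ac)
  also note factor
  also have "qpoch y q (m - Suc k) * qpoch (q / (y * q ^ m)) q k * (- (y * q ^ m / q)) ^ k * ((1 - y * q ^ (m - Suc k)) * q ^ k)
    = qpoch y q (m - k) * qpoch (q / (y * q ^ m)) q k * (- (y * q ^ m / q)) ^ k * q ^ k"
    unfolding m qpoch_Suc by (simp only: mult_ac)
  also have "\<dots> = qpoch y q m * tri q (Suc k)"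
    unfolding Suc.IH[OF km] tri_Suc by (simp only: mult_ac)
  finally show ?case .
qed simp

text \<open>Modulo \<open>1 - z\<close> this is \<open>(x\<alpha>;D)\<^sub>k / (D/x;D)\<^sub>k\<close>.\<close>
definition wpr :: "'a::field \<Rightarrow> 'a \<Rightarrow> nat \<Rightarrow> 'a \<Rightarrow> nat \<Rightarrow> 'a \<Rightarrow> 'a" where
  "wpr D \<alpha> m z k x = qpoch (D / (x * z)) D m / qpoch (D / x) D m
     * (qpoch (x * \<alpha> / z) D k / qpoch (D / (x * z)) D k)"

text \<open>As z = \<alpha>D^m, reversal turns (x\<alpha>;D) into a factorial at D/(xz) and (D/x;D)
  into one at x\<alpha>/z. For z = 1 numerator and denominator have exchanged roles twice, by
  reversal and by inversion, so up to a monomial the quotient at m - k is the one at k.\<close>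

lemma well_poised_reflect:
  fixes D \<alpha> x z :: "'a::field"
  assumes nz: "D \<noteq> 0" "\<alpha> \<noteq> 0" "x \<noteq> 0" and z: "z = \<alpha> * D ^ m" and k: "k \<le> m"
    and nzq: "qpoch (D / x) D m \<noteq> 0" "qpoch (D / (x * z)) D m \<noteq> 0"
  shows "qpoch (x * \<alpha>) D (m - k) / qpoch (D / x) D (m - k)
         = wpr D \<alpha> m z k x * ((- (x * z / D)) ^ m / tri D m * (D / (\<alpha> * x\<^sup>2)) ^ k)"
proof -
  have z0: "z \<noteq> 0" using nz z by simp
  have nzk: "qpoch (D / (x * z)) D k \<noteq> 0" "qpoch (D / x) D (m - k) \<noteq> 0"
    using nzq k by (auto elim!: qpoch_nonzeroD)
  have tr: "tri D k \<noteq> 0" "tri D m \<noteq> 0" using nz by (simp_all add: tri_nonzero)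
  have 1: "qpoch (x * \<alpha>) D (m - k) * qpoch (D / (x * z)) D k * (- (x * z / D)) ^ k = qpoch (x * \<alpha>) D m * tri D k"
    using qpoch_reverse[of D "x * \<alpha>" k m] nz k by (simp add: z mult_ac)
  have 2: "qpoch (D / x) D (m - k) * qpoch (x * \<alpha> / z) D k * (- (z / (\<alpha> * x))) ^ k = qpoch (D / x) D m * tri D k"
    using qpoch_reverse[of D "D / x" k m] nz k by (simp add: z mult_ac)
  have 3: "qpoch (x * \<alpha>) D m = qpoch (D / (x * z)) D m * ((- (x * z / D)) ^ m / tri D m)"
  proof -
    have l: "D / (D / (x * z) * D ^ m) = x * \<alpha>" using nz z0 by (simp add: z)
    have "qpoch (D / (x * z)) D m = qpoch (x * \<alpha>) D m * ((- (D / (x * z))) ^ m * tri D m)"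
      using qpoch_reverse_neg[of D "D / (x * z)" m] nz z0 unfolding l by simp
    moreover have "(- (D / (x * z))) ^ m * (- (x * z / D)) ^ m = 1"
      using nz z0 by (simp flip: power_mult_distrib)
    ultimately show ?thesis
      using tr by (simp add: mult_ac)
  qed
  have 4: "(- (z / (\<alpha> * x))) ^ k = (- (x * z / D)) ^ k * (D / (\<alpha> * x\<^sup>2)) ^ k"
    unfolding power_mult_distrib[symmetric] using nz by (simp add: power2_eq_square)
  have nzp: "(- (x * z / D)) ^ k \<noteq> 0" using nz z0 by simp
  have "qpoch (x * \<alpha>) D (m - k) = qpoch (x * \<alpha>) D m * tri D k / (qpoch (D / (x * z)) D k * (- (x * z / D)) ^ k)"
    using nzk nzp 1 by (subst eq_divide_eq) (simp add: mult_ac)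
  moreover have "1 / qpoch (D / x) D (m - k)
      = qpoch (x * \<alpha> / z) D k * ((- (x * z / D)) ^ k * (D / (\<alpha> * x\<^sup>2)) ^ k) / (qpoch (D / x) D m * tri D k)"
    using nzk nzq tr 2 unfolding 4 by (simp add: frac_eq_eq mult_ac)
  ultimately have "qpoch (x * \<alpha>) D (m - k) * (1 / qpoch (D / x) D (m - k))
      = (qpoch (x * \<alpha>) D m * tri D k / (qpoch (D / (x * z)) D k * (- (x * z / D)) ^ k))
        * (qpoch (x * \<alpha> / z) D k * ((- (x * z / D)) ^ k * (D / (\<alpha> * x\<^sup>2)) ^ k) / (qpoch (D / x) D m * tri D k))"
    by simp
  then show ?thesis
    using nzp tr nz z0 unfolding 3 wpr_def by (simp add: mult_ac)
qed

text \<open>Product of five reflections, for x = 1, c, e, a, 1/a. The extra factor on the left is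
  the one that \<open>cleared_reflect\<close> produces; it makes the monomials collapse. For z = 1
  the right-hand side is the summand at k with opposite sign, because of \<alpha>D^(2k) -
  z^2.\<close>

lemma vwp_reflect:
  fixes D \<alpha> a c e z :: "'a::field"
  assumes nz: "D \<noteq> 0" "\<alpha> \<noteq> 0" "c \<noteq> 0" "e \<noteq> 0" "a \<noteq> 0" and z: "z = \<alpha> * D ^ m" and k: "k \<le> m"
    and nzq: "\<And>x. x \<in> {1, c, e, a, 1 / a} \<Longrightarrow> qpoch (D / x) D m \<noteq> 0 \<and> qpoch (D / (x * z)) D m \<noteq> 0"
  shows "vwp D \<alpha> a c e (m - k) * ((- 1) ^ m * (D / \<alpha>) ^ k / (D ^ m * tri D m))
         = z ^ (2 * m) / z * (\<alpha> * D ^ (2 * k) - z\<^sup>2)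
           * (wpr D \<alpha> m z k 1 * wpr D \<alpha> m z k c * wpr D \<alpha> m z k e * wpr D \<alpha> m z k a * wpr D \<alpha> m z k (1 / a))
           * (D\<^sup>2 / (\<alpha> ^ 3 * c * e)) ^ k"
proof -
  have z0: "z \<noteq> 0" using nz z by simp
  have tr: "tri D m \<noteq> 0" using nz by (simp add: tri_nonzero)
  define g where "g = D\<^sup>2 / (\<alpha> ^ 3 * c * e)"
  define mon where "mon x = (- (x * z / D)) ^ m / tri D m * (D / (\<alpha> * x\<^sup>2)) ^ k" for x
  define R where "R x = qpoch (x * \<alpha>) D (m - k) / qpoch (D / x) D (m - k)" for x
  define w where "w = (- 1) ^ m * (D / \<alpha>) ^ k / (D ^ m * tri D m)"
  have R: "R x = wpr D \<alpha> m z k x * mon x" if "x \<in> {1, c, e, a, 1 / a}" for x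
  proof -
    have "x \<noteq> 0" using that nz by auto
    with nzq[OF that] show ?thesis
      unfolding R_def mon_def by (intro well_poised_reflect nz z k) auto
  qed
  have v: "vwp D \<alpha> a c e (m - k) = (1 - \<alpha> * D ^ (2 * (m - k))) * (R 1 * R c * R e * R a * R (1 / a)) * g ^ (m - k)"
    by (simp add: vwp_def R_def g_def mult_ac)
  have sq: "(1 - \<alpha> * D ^ (2 * (m - k))) * (\<alpha> * D ^ (2 * k)) = \<alpha> * D ^ (2 * k) - z\<^sup>2"
  proof -
    have "D ^ (2 * (m - k)) * D ^ (2 * k) = (D ^ m)\<^sup>2"
      using k by (simp flip: power_add power_mult add: algebra_simps)
    then have "\<alpha> * D ^ (2 * (m - k)) * (\<alpha> * D ^ (2 * k)) = z\<^sup>2"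
      by (simp add: z power2_eq_square mult_ac)
    then show ?thesis by (simp add: algebra_simps)
  qed
  \<comment> \<open>\<open>w\<close> acts as a sixth monomial: it makes the sign even and completes
    the powers of D. The surviving \<alpha>D^(2k) is what \<open>sq\<close> needs to reflect the
    very-well-poised factor.\<close>
  have mons: "mon 1 * mon c * mon e * mon a * mon (1 / a) * w * g ^ (m - k) = z ^ (2 * m) / z * (\<alpha> * D ^ (2 * k)) * g ^ k"
  proof -
    have x1: "(- (1 * z / D)) * (- (c * z / D)) * (- (e * z / D)) * (- (a * z / D)) * (- (1 / a * z / D)) * (- 1) / D
        = z ^ 5 * (c * e) / D ^ 6"
      using nz by (simp add: power_numeral_reduce field_simps)
    have x2: "(D / (\<alpha> * 1\<^sup>2)) * (D / (\<alpha> * c\<^sup>2)) * (D / (\<alpha> * e\<^sup>2)) * (D / (\<alpha> * a\<^sup>2)) * (D / (\<alpha> * (1 / a)\<^sup>2)) * (D / \<alpha>)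
        = D ^ 6 / (\<alpha> ^ 6 * (c * e)\<^sup>2)"
      using nz by (simp add: power_numeral_reduce power2_eq_square field_simps)
    have "mon 1 * mon c * mon e * mon a * mon (1 / a) * w
       = ((- (1 * z / D)) * (- (c * z / D)) * (- (e * z / D)) * (- (a * z / D)) * (- (1 / a * z / D)) * (- 1) / D) ^ m
         * ((D / (\<alpha> * 1\<^sup>2)) * (D / (\<alpha> * c\<^sup>2)) * (D / (\<alpha> * e\<^sup>2)) * (D / (\<alpha> * a\<^sup>2)) * (D / (\<alpha> * (1 / a)\<^sup>2)) * (D / \<alpha>)) ^ k
         / tri D m ^ 6"
      unfolding mon_def w_def power_mult_distrib power_divide[of "_ * (- 1)"] by (simp add: power_numeral_reduce mult_ac)
    then have M: "mon 1 * mon c * mon e * mon a * mon (1 / a) * w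
       = (z ^ 5 * (c * e) / D ^ 6) ^ m * (D ^ 6 / (\<alpha> ^ 6 * (c * e)\<^sup>2)) ^ k / tri D m ^ 6"
      unfolding x1 x2 .
    have gk: "g ^ (m - k) * g ^ k = g ^ m" using k by (simp flip: power_add)
    have e1: "(z ^ 5 * (c * e) / D ^ 6) ^ m * g ^ m = (z\<^sup>2) ^ m * (z / (\<alpha> * D)) ^ m * ((z / (\<alpha> * D)) ^ m)\<^sup>2 / D ^ m"
    proof -
      have "(z ^ 5 * (c * e) / D ^ 6) * g = z\<^sup>2 * (z / (\<alpha> * D)) * (z / (\<alpha> * D))\<^sup>2 / D"
        using nz by (simp add: g_def power_numeral_reduce power2_eq_square field_simps)
      then have "((z ^ 5 * (c * e) / D ^ 6) * g) ^ m = (z\<^sup>2 * (z / (\<alpha> * D)) * (z / (\<alpha> * D))\<^sup>2 / D) ^ m"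
        by (rule arg_cong)
      then show ?thesis
        by (simp only: power_mult_distrib power_divide power_mult[symmetric] mult.commute)
    qed
    have e2: "(D ^ 6 / (\<alpha> ^ 6 * (c * e)\<^sup>2)) ^ k = (D\<^sup>2) ^ k * g ^ k * g ^ k"
    proof -
      have "D ^ 6 / (\<alpha> ^ 6 * (c * e)\<^sup>2) = D\<^sup>2 * g * g"
        using nz by (simp add: g_def power_numeral_reduce power2_eq_square field_simps)
      then show ?thesis by (simp only: power_mult_distrib)
    qed
    \<comment> \<open>z/(\<alpha>D) is D^(m-1), and D^(m(m-1)) is the square of
      \<open>tri D m\<close>. The extra D^m avoids the exponent m - 1.\<close>
    have zt: "(z / (\<alpha> * D)) ^ m * D ^ m = tri D m ^ 2 * D ^ m"
    proof -
      have "z / (\<alpha> * D) * D = D ^ m" using nz by (simp add: z)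
      then have "(z / (\<alpha> * D)) ^ m * D ^ m = (D ^ m) ^ m" by (metis power_mult_distrib)
      then show ?thesis using tri_square[of D m] by (simp add: power2_eq_square power_mult)
    qed
    then have zt: "(z / (\<alpha> * D)) ^ m = tri D m ^ 2" using nz by simp
    have zD: "1 / D ^ m = \<alpha> / z" using nz by (simp add: z)
    have "mon 1 * mon c * mon e * mon a * mon (1 / a) * w * g ^ (m - k) * g ^ k
        = (z ^ 5 * (c * e) / D ^ 6) ^ m * g ^ m * (D ^ 6 / (\<alpha> ^ 6 * (c * e)\<^sup>2)) ^ k / tri D m ^ 6"
      unfolding M gk[symmetric] by (simp add: mult_ac)
    also have "\<dots> = (z\<^sup>2) ^ m * (D\<^sup>2) ^ k * g ^ k * g ^ k * (1 / D ^ m)"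
      unfolding e1 e2 zt using tr by (simp add: power_numeral_reduce power2_eq_square field_simps)
    also have "\<dots> = z ^ (2 * m) / z * (\<alpha> * D ^ (2 * k)) * g ^ k * g ^ k"
      unfolding zD power_mult by (simp add: mult_ac)
    finally have "mon 1 * mon c * mon e * mon a * mon (1 / a) * w * g ^ (m - k) * g ^ k
        = z ^ (2 * m) / z * (\<alpha> * D ^ (2 * k)) * g ^ k * g ^ k" .
    moreover have "g ^ k \<noteq> 0" using nz by (simp add: g_def)
    ultimately show ?thesis
      using mult_right_cancel by blast
  qed
  have "vwp D \<alpha> a c e (m - k) * w = (1 - \<alpha> * D ^ (2 * (m - k)))
       * (wpr D \<alpha> m z k 1 * wpr D \<alpha> m z k c * wpr D \<alpha> m z k e * wpr D \<alpha> m z k a * wpr D \<alpha> m z k (1 / a))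
       * (mon 1 * mon c * mon e * mon a * mon (1 / a) * w * g ^ (m - k))"
    unfolding v by (simp add: R)
  also have "\<dots> = z ^ (2 * m) / z * ((1 - \<alpha> * D ^ (2 * (m - k))) * (\<alpha> * D ^ (2 * k)))
       * (wpr D \<alpha> m z k 1 * wpr D \<alpha> m z k c * wpr D \<alpha> m z k e * wpr D \<alpha> m z k a * wpr D \<alpha> m z k (1 / a)) * g ^ k"
    unfolding mons by (simp only: mult_ac)
  finally show ?thesis
    unfolding sq w_def g_def .
qed

text \<open>\<open>b\<^sup>k(\<alpha>/b;D)\<^sub>k / (bD;D)\<^sub>k\<close> multiplied by \<open>(bD;D)\<^sub>m\<close>. Reversal turns it into \<open>cleared'\<close>, which
agrees with it modulo \<open>1 - z\<close>, to first order in \<open>b - 1\<close>.\<close>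
definition cleared :: "'a::field \<Rightarrow> 'a \<Rightarrow> nat \<Rightarrow> nat \<Rightarrow> 'a \<Rightarrow> 'a" where
  "cleared D \<alpha> m k b = (\<Prod>i<m. if i < k then b - \<alpha> * D ^ i else 1 - b * D ^ Suc i)"

definition cleared' :: "'a::field \<Rightarrow> 'a \<Rightarrow> 'a \<Rightarrow> nat \<Rightarrow> nat \<Rightarrow> 'a \<Rightarrow> 'a" where
  "cleared' D \<alpha> z m k b = (\<Prod>i<m. if i < k then b * z - \<alpha> * D ^ i else z - b * D ^ Suc i)"

lemma cleared_conv_qpoch:
  assumes "k \<le> m"
  shows "cleared D \<alpha> m k b * qpoch (b * D) D k = (\<Prod>i<k. b - \<alpha> * D ^ i) * qpoch (b * D) D m"
  using assms
proof (induction m rule: dec_induct)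
  case base
  then show ?case by (simp add: cleared_def)
next
  case (step m)
  have "cleared D \<alpha> (Suc m) k b = cleared D \<alpha> m k b * (1 - b * D ^ Suc m)"
    using step.hyps by (simp add: cleared_def)
  with step show ?case by (simp add: qpoch_Suc mult_ac)
qed

text \<open>Under i -> m - 1 - i the two kinds of factors change places, since D^m = z/\<alpha>: 1 -
  b D^(m-i) = -(b z - \<alpha>D^i)/(\<alpha>D^i) and b - \<alpha>D^(m-1-i) = -(z - b
  D^(i+1))/D^(i+1).\<close>

lemma cleared_reflect:
  assumes nz: "D \<noteq> 0" "\<alpha> \<noteq> 0" and z: "z = \<alpha> * D ^ m" and k: "k \<le> m"
  shows "cleared D \<alpha> m (m - k) b = (- 1) ^ m * (D / \<alpha>) ^ k / (D ^ m * tri D m) * cleared' D \<alpha> z m k b"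
proof -
  have "cleared D \<alpha> m (m - k) b
     = (\<Prod>i<m. if m - Suc i < m - k then b - \<alpha> * D ^ (m - Suc i) else 1 - b * D ^ Suc (m - Suc i))"
    unfolding cleared_def by (rule prod.nat_diff_reindex[symmetric])
  also have "\<dots> = (\<Prod>i<m. (- 1 / D ^ Suc i * (if i < k then D / \<alpha> else 1))
      * (if i < k then b * z - \<alpha> * D ^ i else z - b * D ^ Suc i))"
  proof (intro prod.cong refl)
    fix i assume "i \<in> {..<m}"
    then have i: "i < m" by simp
    then have Dm: "D ^ m = D ^ (m - Suc i) * D ^ Suc i" by (simp only: power_add[symmetric]) simp
    have less: "m - Suc i < m - k \<longleftrightarrow> \<not> i < k" using i k by auto
    have "Suc (m - Suc i) = m - i" using i by simp
    moreover have Dm': "D ^ m = D ^ (m - i) * D ^ i" using i by (simp flip: power_add)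
    have "1 - b * D ^ (m - i) = - 1 / D ^ Suc i * (D / \<alpha>) * (b * z - \<alpha> * D ^ i)"
      using nz unfolding z Dm' by (simp add: field_simps)
    moreover have "b - \<alpha> * D ^ (m - Suc i) = - 1 / D ^ Suc i * 1 * (z - b * D ^ Suc i)"
      using nz unfolding z Dm by (simp add: field_simps)
    ultimately show "(if m - Suc i < m - k then b - \<alpha> * D ^ (m - Suc i) else 1 - b * D ^ Suc (m - Suc i))
       = - 1 / D ^ Suc i * (if i < k then D / \<alpha> else 1) * (if i < k then b * z - \<alpha> * D ^ i else z - b * D ^ Suc i)"
      unfolding less by presburger
  qed
  also have "\<dots> = (\<Prod>i<m. - 1 / D ^ Suc i) * (\<Prod>i<m. if i < k then D / \<alpha> else 1) * cleared' D \<alpha> z m k b"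
    by (simp only: prod.distrib cleared'_def)
  also have "(\<Prod>i<m. if i < k then D / \<alpha> else 1) = (D / \<alpha>) ^ k"
  proof -
    have "{..<m} \<inter> {i. i < k} = {..<k}" using k by auto
    then show ?thesis by (simp add: prod.If_cases)
  qed
  also have "(\<Prod>i<m. - 1 / D ^ Suc i) = (- 1) ^ m / (D ^ m * tri D m)"
    by (induction m) (simp_all add: tri_Suc mult_ac)
  finally show ?thesis by simp
qed

section \<open>Cyclotomic polynomials\<close>

abbreviation xpow1 :: "nat \<Rightarrow> rat poly" where
  "xpow1 n \<equiv> monom 1 n - 1"

lemma xpow1_dvd: "d dvd n \<Longrightarrow> xpow1 d dvd xpow1 n"
proof (elim dvdE)
  fix k assume "n = d * k"
  then have "monom (1::rat) n = monom 1 d ^ k" by (simp add: monom_power mult.commute)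
  then show ?thesis by (simp add: power_diff_1_eq)
qed

text \<open>Euclid's algorithm on the exponents: x^m - 1 and x^(m mod n) - 1 agree modulo x^n -
  1.\<close>

lemma xpow1_gcd:
  assumes "h dvd xpow1 m" "h dvd xpow1 n"
  shows "h dvd xpow1 (gcd m n)"
  using assms
proof (induction m n rule: gcd_nat_induct)
  case (step m n)
  have eq: "monom (1::rat) m = monom 1 (m mod n) * monom 1 (n * (m div n))"
    by (simp add: mult_monom)
  have "h dvd xpow1 (n * (m div n))"
    using step.prems(2) by (rule dvd_trans) (simp add: xpow1_dvd)
  then have "h dvd monom 1 (m mod n) * xpow1 (n * (m div n))"
    by (rule dvd_mult)
  with step.prems(1) have "h dvd xpow1 m - monom 1 (m mod n) * xpow1 (n * (m div n))"
    by (rule dvd_diff)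
  then have "h dvd xpow1 (m mod n)"
    by (simp add: eq algebra_simps)
  then have "h dvd xpow1 (gcd n (m mod n))"
    using step by simp
  then show ?case by (simp only: gcd_red_nat[of m n])
qed simp

lemma prod_coprime_dvd:
  fixes f :: "'b \<Rightarrow> 'a::semiring_gcd"
  assumes "finite A" "\<And>i. i \<in> A \<Longrightarrow> f i dvd x"
    and "\<And>i j. i \<in> A \<Longrightarrow> j \<in> A \<Longrightarrow> i \<noteq> j \<Longrightarrow> coprime (f i) (f j)"
  shows "prod f A dvd x"
  using assms
proof (induction rule: finite_induct)
  case (insert i A)
  have "coprime (f i) (prod f A)"
    using insert by (intro prod_coprime_right) auto
  moreover have "prod f A dvd x" using insert by auto
  ultimately show ?case using insert by (simp add: divides_mult)
qed simp

lemma xpow1_nonzero: "0 < n \<Longrightarrow> xpow1 n \<noteq> 0"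
proof
  assume "0 < n" and "xpow1 n = 0"
  then have "degree (monom (1::rat) n) = 0" by simp
  with \<open>0 < n\<close> show False by (simp add: degree_monom_eq)
qed

text \<open>A common divisor divides x times the derivative, hence x^n because n is invertible,
  hence 1.\<close>

lemma coprime_xpow1_pderiv: "0 < n \<Longrightarrow> coprime (xpow1 n) (pderiv (xpow1 n))"
proof (rule coprimeI)
  fix h assume n: "0 < n" and h: "h dvd xpow1 n" "h dvd pderiv (xpow1 n)"
  have "pderiv (xpow1 n) = smult (of_nat n) (monom 1 (n - 1))"
    by (simp add: pderiv_diff pderiv_monom smult_monom)
  then have "h dvd monom 1 (n - 1)"
    using h(2) n dvd_smult_cancel[of h "of_nat n" "monom 1 (n - 1)"] by simp
  then have "h dvd monom 1 1 * monom 1 (n - 1)" by (rule dvd_mult)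
  then have "h dvd monom 1 n" using n by (simp add: mult_monom)
  then have "h dvd monom 1 n - xpow1 n" using h(1) by (rule dvd_diff)
  then show "is_unit h" by simp
qed

lemma squarefree_xpow1: "0 < n \<Longrightarrow> h * h dvd xpow1 n \<Longrightarrow> is_unit h"
proof -
  assume n: "0 < n" and "h * h dvd xpow1 n"
  then obtain k where k: "xpow1 n = h * h * k" by (auto elim: dvdE)
  then have "h dvd xpow1 n" by simp
  moreover have "h dvd pderiv (xpow1 n)"
    unfolding k by (simp add: pderiv_mult)
  ultimately show "is_unit h"
    using coprime_xpow1_pderiv[OF n] by (meson coprime_common_divisor)
qed

declare cyclo.simps [simp del]

text \<open>The three claims feed each other. Coprimality below n makes the product over the proper
  divisors divide x^n - 1, so the \<open>div\<close> defining \<open>cyclo n\<close> is exact. The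
  product formula at g < n then gives coprimality at n, since a common divisor would divide the
  squarefree x^n - 1 twice.\<close>

lemma cyclo_dvd_and_coprime:
  assumes "0 < n"
  shows "cyclo n dvd xpow1 n \<and> (\<forall>g. g dvd n \<and> g < n \<longrightarrow> coprime (cyclo n) (xpow1 g))
         \<and> (\<Prod>d\<in>{d. d dvd n}. cyclo d) = xpow1 n"
  using assms
proof (induction n rule: less_induct)
  case (less n)
  let ?S = "{d. d dvd n \<and> d < n}"
  define Q where "Q = (\<Prod>d\<in>?S. cyclo d)"
  have pos: "0 < d" if "d dvd n" for d
    using that less.prems by (auto intro!: Nat.gr0I)
  have fin: "finite {d. d dvd n}" using less.prems by simp
  have finS: "finite ?S" by simp
  have IH: "cyclo d dvd xpow1 d" "\<And>g. g dvd d \<Longrightarrow> g < d \<Longrightarrow> coprime (cyclo d) (xpow1 g)"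
      "(\<Prod>d'\<in>{d'. d' dvd d}. cyclo d') = xpow1 d" if "d \<in> ?S" for d
    using less.IH[of d] that pos[of d] by auto
  have cop': "coprime (cyclo i) (cyclo j)" if "i \<in> ?S" "j \<in> ?S" "i < j" for i j
  proof (rule coprimeI)
    fix h assume h: "h dvd cyclo i" "h dvd cyclo j"
    have "h dvd xpow1 i" using h(1) IH(1)[OF that(1)] by (rule dvd_trans)
    moreover have "h dvd xpow1 j" using h(2) IH(1)[OF that(2)] by (rule dvd_trans)
    ultimately have "h dvd xpow1 (gcd i j)" by (rule xpow1_gcd)
    moreover have "gcd i j < j"
    proof -
      have "gcd i j \<le> i" using that(1) pos[of i] by (intro gcd_le1_nat) simp
      then show ?thesis using that(3) by simp
    qed
    then have "coprime (cyclo j) (xpow1 (gcd i j))"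
      using IH(2)[OF that(2)] by simp
    ultimately show "is_unit h" using h(2) by (meson coprime_common_divisor)
  qed
  have cop: "coprime (cyclo i) (cyclo j)" if "i \<in> ?S" "j \<in> ?S" "i \<noteq> j" for i j
    using that cop'[of i j] cop'[of j i] by (cases i j rule: linorder_cases) (auto simp: coprime_commute)
  have "Q dvd xpow1 n"
    unfolding Q_def
  proof (rule prod_coprime_dvd)
    show "cyclo d dvd xpow1 n" if "d \<in> ?S" for d
      by (rule dvd_trans[OF IH(1)[OF that] xpow1_dvd]) (use that in simp)
  qed (use cop in auto)
  moreover have "cyclo n = xpow1 n div Q"
    using less.prems by (subst cyclo.simps) (simp add: Q_def)
  ultimately have eq: "cyclo n * Q = xpow1 n" by simp
  have "coprime (cyclo n) (xpow1 g)" if "g dvd n" "g < n" for g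
  proof -
    have "{d. d dvd g} \<subseteq> ?S"
    proof
      fix d assume "d \<in> {d. d dvd g}"
      then have "d dvd g" by simp
      then have "d dvd n" "d \<le> g"
        using that pos[of g] dvd_trans[of d g n] dvd_imp_le[of d g] by simp_all
      then show "d \<in> ?S" using that by simp
    qed
    then have "(\<Prod>d\<in>{d. d dvd g}. cyclo d) dvd Q"
      unfolding Q_def using finS by (rule prod_dvd_prod_subset[rotated])
    then have "xpow1 g dvd Q" using IH(3)[of g] that by simp
    show ?thesis
    proof (rule coprimeI)
      fix h assume "h dvd cyclo n" "h dvd xpow1 g"
      then have "h * h dvd cyclo n * Q"
        using \<open>xpow1 g dvd Q\<close> dvd_trans[of h "xpow1 g" Q] by (intro mult_dvd_mono) simp_all
      then show "is_unit h" unfolding eq by (rule squarefree_xpow1[OF less.prems])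
    qed
  qed
  moreover have "(\<Prod>d\<in>{d. d dvd n}. cyclo d) = xpow1 n"
  proof -
    have "{d. d dvd n} = insert n ?S" using less.prems by (auto dest: dvd_imp_le)
    then show ?thesis using finS by (simp add: eq[symmetric] Q_def)
  qed
  moreover have "cyclo n dvd xpow1 n" unfolding eq[symmetric] by simp
  ultimately show ?case by blast
qed

lemma cyclo_dvd: "0 < n \<Longrightarrow> cyclo n dvd xpow1 n"
  using cyclo_dvd_and_coprime by blast

lemma cyclo_nonzero: "0 < n \<Longrightarrow> cyclo n \<noteq> 0"
  using cyclo_dvd[of n] xpow1_nonzero[of n] by auto

lemma coprime_cyclo_xpow1:
  assumes "0 < n" "\<not> n dvd j"
  shows "coprime (cyclo n) (xpow1 j)"
proof (rule coprimeI)
  fix h assume h: "h dvd cyclo n" "h dvd xpow1 j"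
  have "h dvd xpow1 (gcd n j)"
    by (rule xpow1_gcd[OF dvd_trans[OF h(1) cyclo_dvd[OF assms(1)]] h(2)])
  moreover have "gcd n j < n"
  proof -
    have "gcd n j \<le> n" using assms by simp
    moreover have "gcd n j \<noteq> n" using assms gcd_dvd2[of n j] by metis
    ultimately show ?thesis by simp
  qed
  then have "coprime (cyclo n) (xpow1 (gcd n j))"
    using cyclo_dvd_and_coprime[OF assms(1)] by simp
  ultimately show "is_unit h" using h(1) coprime_common_divisor by metis
qed

lemma degree_xpow1: "0 < n \<Longrightarrow> degree (xpow1 n) = n"
  using degree_add_eq_left[of "- 1" "monom (1::rat) n"] by (simp add: degree_monom_eq)

text \<open>The degrees satisfy the divisor-sum recurrence of the totient. Its positivity later
  shows that \<open>PhiQ n\<close> is not a unit.\<close>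

lemma degree_cyclo: "0 < n \<Longrightarrow> degree (cyclo n) = totient n"
proof (induction n rule: less_induct)
  case (less n)
  let ?S = "{d. d dvd n \<and> d < n}"
  have eq: "{d. d dvd n} = insert n ?S" using less.prems by (auto dest: dvd_imp_le)
  have fin: "finite ?S" by simp
  have pos: "0 < d" if "d dvd n" for d
    using that less.prems by (auto intro!: Nat.gr0I)
  have "n = degree (\<Prod>d\<in>{d. d dvd n}. cyclo d)"
    using cyclo_dvd_and_coprime[OF less.prems] degree_xpow1[OF less.prems] by simp
  also have "\<dots> = (\<Sum>d\<in>{d. d dvd n}. degree (cyclo d))"
    using pos cyclo_nonzero by (subst degree_prod_eq_sum_degree) (auto simp: o_def)
  also have "\<dots> = degree (cyclo n) + (\<Sum>d\<in>?S. degree (cyclo d))"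
    unfolding eq using fin by simp
  also have "(\<Sum>d\<in>?S. degree (cyclo d)) = (\<Sum>d\<in>?S. totient d)"
    using less.IH pos by (intro sum.cong) auto
  finally have "n = degree (cyclo n) + (\<Sum>d\<in>?S. totient d)" .
  moreover have "n = totient n + (\<Sum>d\<in>?S. totient d)"
    using totient_divisor_sum[of n] fin unfolding eq by simp
  ultimately show ?case by simp
qed

section \<open>Congruences of rational functions\<close>

lemma emb_simps: "emb (x + y) = emb x + emb y" "emb (x - y) = emb x - emb y"
  "emb (x * y) = emb x * emb y" "emb 0 = 0" "emb 1 = 1"
  by (simp_all add: emb_def fract_collapse)

lemma emb_power: "emb (x ^ n) = emb x ^ n"
  by (induction n) (simp_all add: emb_simps)

lemma emb_eq_0_iff [simp]: "emb x = 0 \<longleftrightarrow> x = 0"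
  by (simp add: emb_def Zero_fract_def eq_fract)

lemma emb_eq_iff [simp]: "emb x = emb y \<longleftrightarrow> x = y"
  by (simp add: emb_def eq_fract)

text \<open>\<open>pint P\<close> is the ring of fractions with denominator coprime to P,
  \<open>punit P\<close> a group of units in it, and \<open>pdiv P\<close> the ideal generated by P.
  Thus \<open>rcong\<close> is membership of the difference in that ideal.\<close>

definition pint :: "mpoly4 \<Rightarrow> rfun4 \<Rightarrow> bool" where
  "pint P x \<longleftrightarrow> (\<exists>F G. G \<noteq> 0 \<and> coprime G P \<and> x = emb F / emb G)"

definition punit :: "mpoly4 \<Rightarrow> rfun4 \<Rightarrow> bool" where
  "punit P x \<longleftrightarrow> (\<exists>F G. F \<noteq> 0 \<and> G \<noteq> 0 \<and> coprime F P \<and> coprime G P \<and> x = emb F / emb G)"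

definition pdiv :: "mpoly4 \<Rightarrow> rfun4 \<Rightarrow> bool" where
  "pdiv P x \<longleftrightarrow> (\<exists>w. pint P w \<and> x = emb P * w)"

text \<open>Integrality of both sides is part of the relation, since congruences could not be
  multiplied otherwise.\<close>

definition pcong :: "mpoly4 \<Rightarrow> rfun4 \<Rightarrow> rfun4 \<Rightarrow> bool" where
  "pcong P x y \<longleftrightarrow> pint P x \<and> pint P y \<and> pdiv P (x - y)"

lemma rcong_iff_pdiv: "rcong x y P \<longleftrightarrow> pdiv P (x - y)"
  unfolding rcong_def pdiv_def pint_def by (metis times_divide_eq_right)

lemma pintI: "G \<noteq> 0 \<Longrightarrow> coprime G P \<Longrightarrow> x = emb F / emb G \<Longrightarrow> pint P x"
  unfolding pint_def by blast

lemma pintE: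
  assumes "pint P x"
  obtains F G where "G \<noteq> 0" "coprime G P" "x = emb F / emb G"
  using assms unfolding pint_def by blast

lemma punitI: "F \<noteq> 0 \<Longrightarrow> G \<noteq> 0 \<Longrightarrow> coprime F P \<Longrightarrow> coprime G P \<Longrightarrow> x = emb F / emb G \<Longrightarrow> punit P x"
  unfolding punit_def by blast

lemma punitE:
  assumes "punit P x"
  obtains F G where "F \<noteq> 0" "G \<noteq> 0" "coprime F P" "coprime G P" "x = emb F / emb G"
  using assms unfolding punit_def by blast

lemma pint_emb [simp]: "pint P (emb F)"
  by (rule pintI[of 1]) (simp_all add: emb_simps)

lemma pint_0 [simp]: "pint P 0" and pint_1 [simp]: "pint P 1"
  using pint_emb[of P 0] pint_emb[of P 1] by (simp_all add: emb_simps)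

lemma pint_add: "pint P x \<Longrightarrow> pint P y \<Longrightarrow> pint P (x + y)"
proof (elim pintE)
  fix F G F' G' assume "G \<noteq> 0" "G' \<noteq> 0" "coprime G P" "coprime G' P" "x = emb F / emb G" "y = emb F' / emb G'"
  then show ?thesis
    by (intro pintI[of "G * G'" _ _ "F * G' + F' * G"]) (simp_all add: emb_simps field_simps)
qed

lemma pint_mult: "pint P x \<Longrightarrow> pint P y \<Longrightarrow> pint P (x * y)"
proof (elim pintE)
  fix F G F' G' assume "G \<noteq> 0" "G' \<noteq> 0" "coprime G P" "coprime G' P" "x = emb F / emb G" "y = emb F' / emb G'"
  then show ?thesis
    by (intro pintI[of "G * G'" _ _ "F * F'"]) (simp_all add: emb_simps)
qed

lemma pint_minus: "pint P x \<Longrightarrow> pint P (- x)"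
  using pint_mult[of P "emb (- 1)" x] emb_simps(2)[of 0 1] by (simp add: emb_simps)

lemma pint_diff: "pint P x \<Longrightarrow> pint P y \<Longrightarrow> pint P (x - y)"
  using pint_add[of P x "- y"] pint_minus[of P y] by simp

lemma pint_power2: "pint (P\<^sup>2) x \<longleftrightarrow> pint P x"
  by (simp add: pint_def)

lemma punit_imp_pint: "punit P x \<Longrightarrow> pint P x"
  unfolding punit_def pint_def by blast

lemma punit_inverse: "punit P x \<Longrightarrow> punit P (1 / x)"
proof (elim punitE)
  fix F G assume "F \<noteq> 0" "G \<noteq> 0" "coprime F P" "coprime G P" "x = emb F / emb G"
  then show ?thesis by (intro punitI[of G F]) simp_all
qed

lemma punit_mult: "punit P x \<Longrightarrow> punit P y \<Longrightarrow> punit P (x * y)"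
proof (elim punitE)
  fix F G F' G' assume "F \<noteq> 0" "F' \<noteq> 0" "coprime F P" "coprime F' P"
    "G \<noteq> 0" "G' \<noteq> 0" "coprime G P" "coprime G' P" "x = emb F / emb G" "y = emb F' / emb G'"
  then show ?thesis
    by (intro punitI[of "F * F'" "G * G'"]) (simp_all add: emb_simps)
qed

lemma punit_divide: "punit P x \<Longrightarrow> punit P y \<Longrightarrow> punit P (x / y)"
  using punit_mult[OF _ punit_inverse, of P x y] by simp

lemma punit_emb: "F \<noteq> 0 \<Longrightarrow> coprime F P \<Longrightarrow> punit P (emb F)"
  by (rule punitI[of F 1]) (simp_all add: emb_simps)

lemma punit_1 [simp]: "punit P 1"
  using punit_emb[of 1 P] by (simp add: emb_simps)

lemma punit_minus: "punit P x \<Longrightarrow> punit P (- x)"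
  using punit_mult[of P "emb (- 1)" x] punit_emb[of "- 1" P] emb_simps(2)[of 0 1] by (simp add: emb_simps)

lemma punit_power: "punit P x \<Longrightarrow> punit P (x ^ n)"
  by (induction n) (simp_all add: punit_mult)

lemma punit_powi: "punit P x \<Longrightarrow> punit P (x powi i)"
  using punit_power[of P x "nat i"] punit_power[OF punit_inverse, of P x "nat (- i)"]
  by (simp add: power_int_def inverse_eq_divide)

lemma punit_qpoch: "(\<And>i. i < k \<Longrightarrow> punit P (1 - x * b ^ i)) \<Longrightarrow> punit P (qpoch x b k)"
  by (induction k) (simp_all add: qpoch_Suc punit_mult)

lemma punit_nonzero: "punit P x \<Longrightarrow> x \<noteq> 0"
  unfolding punit_def by auto

lemma pint_divide: "pint P x \<Longrightarrow> punit P y \<Longrightarrow> pint P (x / y)"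
  using pint_mult[OF _ punit_imp_pint[OF punit_inverse], of P x y] by simp

lemma pdiv_0 [simp]: "pdiv P 0"
  unfolding pdiv_def by (intro exI[of _ 0]) simp

lemma pdiv_emb: "pdiv P (emb P)"
  unfolding pdiv_def by (intro exI[of _ 1]) simp

lemma pdiv_add: "pdiv P x \<Longrightarrow> pdiv P y \<Longrightarrow> pdiv P (x + y)"
  unfolding pdiv_def by (metis distrib_left pint_add)

lemma pdiv_mult: "pdiv P x \<Longrightarrow> pint P y \<Longrightarrow> pdiv P (x * y)"
  unfolding pdiv_def by (metis mult.assoc pint_mult)

lemma pdiv_mult': "pint P x \<Longrightarrow> pdiv P y \<Longrightarrow> pdiv P (x * y)"
  using pdiv_mult[of P y x] by (simp add: mult.commute)

lemma pdiv_minus: "pdiv P x \<Longrightarrow> pdiv P (- x)"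
  using pdiv_mult[of P x "- 1"] pint_minus[of P 1] by simp

lemma pdiv_diff: "pdiv P x \<Longrightarrow> pdiv P y \<Longrightarrow> pdiv P (x - y)"
  using pdiv_add[of P x "- y"] pdiv_minus[of P y] by simp

lemma pdiv_sum: "(\<And>i. i \<in> A \<Longrightarrow> pdiv P (f i)) \<Longrightarrow> pdiv P (sum f A)"
  by (induction A rule: infinite_finite_induct) (simp_all add: pdiv_add)

lemma pdiv_divide: "pdiv P x \<Longrightarrow> punit P y \<Longrightarrow> pdiv P (x / y)"
  using pdiv_mult[OF _ punit_imp_pint[OF punit_inverse], of P x y] by simp

lemma pdiv_mult_pdiv: "pdiv P x \<Longrightarrow> pdiv P y \<Longrightarrow> pdiv (P\<^sup>2) (x * y)"
proof -
  assume "pdiv P x" "pdiv P y"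
  then obtain w v where "pint P w" "pint P v" "x = emb P * w" "y = emb P * v"
    unfolding pdiv_def by blast
  then have "pint (P\<^sup>2) (w * v)" "x * y = emb (P\<^sup>2) * (w * v)"
    by (simp_all add: pint_power2 pint_mult emb_power power2_eq_square[of "emb P"])
  then show ?thesis
    unfolding pdiv_def by blast
qed

lemma pcong_refl: "pint P x \<Longrightarrow> pcong P x x"
  by (simp add: pcong_def)

lemma pcong_sym: "pcong P x y \<Longrightarrow> pcong P y x"
  unfolding pcong_def using pdiv_minus[of P "x - y"] by simp

lemma pcong_trans: "pcong P x y \<Longrightarrow> pcong P y z \<Longrightarrow> pcong P x z"
  unfolding pcong_def using pdiv_add[of P "x - y" "y - z"] by simp

lemma pcong_add: "pcong P x y \<Longrightarrow> pcong P u v \<Longrightarrow> pcong P (x + u) (y + v)"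
  unfolding pcong_def using pdiv_add[of P "x - y" "u - v"] by (simp add: pint_add algebra_simps)

lemma pcong_diff: "pcong P x y \<Longrightarrow> pcong P u v \<Longrightarrow> pcong P (x - u) (y - v)"
  unfolding pcong_def using pdiv_diff[of P "x - y" "u - v"] by (simp add: pint_diff algebra_simps)

lemma pcong_mult: "pcong P x y \<Longrightarrow> pcong P u v \<Longrightarrow> pcong P (x * u) (y * v)"
proof -
  assume "pcong P x y" "pcong P u v"
  moreover have "x * u - y * v = (x - y) * u + y * (u - v)" by (simp add: algebra_simps)
  ultimately show ?thesis
    unfolding pcong_def by (simp add: pint_mult pdiv_add pdiv_mult pdiv_mult')
qed

lemma pcong_power: "pcong P x y \<Longrightarrow> pcong P (x ^ n) (y ^ n)"
  by (induction n) (simp_all add: pcong_mult pcong_refl)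

lemma pcong_sum: "(\<And>i. i \<in> A \<Longrightarrow> pcong P (f i) (g i)) \<Longrightarrow> pcong P (sum f A) (sum g A)"
  by (induction A rule: infinite_finite_induct) (simp_all add: pcong_add pcong_refl)

lemma pcong_prod: "(\<And>i. i \<in> A \<Longrightarrow> pcong P (f i) (g i)) \<Longrightarrow> pcong P (prod f A) (prod g A)"
  by (induction A rule: infinite_finite_induct) (simp_all add: pcong_mult pcong_refl)

lemma pcong_qpoch: "pcong P x y \<Longrightarrow> pint P b \<Longrightarrow> pcong P (qpoch x b k) (qpoch y b k)"
  unfolding qpoch_def by (intro pcong_prod pcong_diff pcong_mult pcong_power pcong_refl) simp_all

lemma pcong_punit:
  assumes "pcong P x y" "punit P y" "\<not> is_unit P"
  shows "punit P x"
proof -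
  obtain F G where y: "F \<noteq> 0" "G \<noteq> 0" "coprime F P" "coprime G P" "y = emb F / emb G"
    using assms(2) by (rule punitE)
  obtain w where w: "pint P w" "x - y = emb P * w"
    using assms(1) unfolding pcong_def pdiv_def by blast
  obtain W H where W: "H \<noteq> 0" "coprime H P" "w = emb W / emb H"
    using w(1) by (rule pintE)
  have x: "x = emb (F * H + P * (W * G)) / emb (G * H)"
  proof -
    have "x = y + emb P * w" using w(2) by (simp add: algebra_simps)
    then show ?thesis using y W by (simp add: emb_simps field_simps)
  qed
  have cop: "coprime (F * H + P * (W * G)) P"
  proof (rule coprimeI)
    fix h assume h: "h dvd F * H + P * (W * G)" "h dvd P"
    then have "h dvd F * H" by (metis dvd_add_left_iff dvd_mult2)
    moreover have "coprime (F * H) P" using y W by simp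
    ultimately show "is_unit h" using h(2) coprime_common_divisor by blast
  qed
  \<comment> \<open>Zero is coprime to P only when P is a unit.\<close>
  then have "F * H + P * (W * G) \<noteq> 0"
    using assms(3) by auto
  then show ?thesis
    using cop y W by (intro punitI[OF _ _ _ _ x]) simp_all
qed

lemma pcong_divide:
  assumes "pcong P x y" "pcong P u v" "punit P v" "\<not> is_unit P"
  shows "pcong P (x / u) (y / v)"
proof -
  have u: "punit P u" using assms(2-4) by (rule pcong_punit)
  note nz = punit_nonzero[OF u] punit_nonzero[OF assms(3)]
  have "x / u - y / v = ((x - y) * v + - y * (u - v)) / (u * v)"
    using nz by (simp add: field_simps)
  moreover have "pdiv P ((x - y) * v + - y * (u - v))"
    using assms unfolding pcong_def by (intro pdiv_add pdiv_mult pdiv_mult' pint_minus) simp_all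
  ultimately have "pdiv P (x / u - y / v)"
    using u assms(3) by (simp add: pdiv_divide punit_mult)
  then show ?thesis
    using assms u by (simp add: pcong_def pint_divide)
qed

text \<open>Both divisibilities are read off one fraction: if x = F/G in lowest terms and x = R L/K
  with K coprime to R, then R divides F and G divides K.\<close>

lemma pdiv_coprime_mult:
  assumes "pdiv P x" "pdiv Q x" "coprime P Q"
  shows "pdiv (P * Q) x"
proof -
  obtain F1 G1 where 1: "G1 \<noteq> 0" "coprime G1 P" "x = emb P * (emb F1 / emb G1)"
    using assms(1) unfolding pdiv_def by (blast elim: pintE)
  obtain F2 G2 where 2: "G2 \<noteq> 0" "coprime G2 Q" "x = emb Q * (emb F2 / emb G2)"
    using assms(2) unfolding pdiv_def by (blast elim: pintE)
  obtain F G where FG: "P * F1 = F * gcd (P * F1) G1" "G1 = G * gcd (P * F1) G1" "coprime F G"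
    using gcd_coprime_exists[of "P * F1" G1] 1(1) by auto
  define h where "h = gcd (P * F1) G1"
  have h: "P * F1 = F * h" "G1 = G * h" and h0: "h \<noteq> 0" "G \<noteq> 0"
    using FG 1(1) by (auto simp: h_def)
  have x: "x = emb F / emb G"
  proof -
    have "x = emb (P * F1) / emb G1" using 1(3) by (simp add: emb_simps)
    then show ?thesis using h0 unfolding h by (simp add: emb_simps)
  qed
  have dvd: "R dvd F \<and> coprime G R" if R: "K \<noteq> 0" "coprime K R" "x = emb R * (emb L / emb K)" for R L K
  proof -
    have "emb (F * K) = emb (R * L * G)"
      using R(3) x R(1) h0 by (simp add: emb_simps field_simps)
    then have eq: "F * K = R * L * G" by simp
    have "R dvd F * K" unfolding eq by simp
    then have "R dvd F" using R(2) by (simp add: coprime_commute coprime_dvd_mult_left_iff)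
    moreover have "G dvd F * K" unfolding eq by simp
    then have "G dvd K" using FG(3) by (simp add: coprime_commute coprime_dvd_mult_right_iff)
    then have "coprime G R" using R(2) by (rule coprime_divisors[OF _ dvd_refl])
    ultimately show ?thesis by simp
  qed
  have "P * Q dvd F"
    using dvd[OF 1] dvd[OF 2] assms(3) by (simp add: divides_mult)
  then obtain W where "F = P * Q * W" by (rule dvdE)
  then have "x = emb (P * Q) * (emb W / emb G)"
    unfolding x by (simp add: emb_simps)
  moreover have "coprime G (P * Q)"
    using dvd[OF 1] dvd[OF 2] by simp
  ultimately show ?thesis
    using h0 unfolding pdiv_def by (blast intro: pintI)
qed

section \<open>Coprimality in nested polynomial rings\<close>

lemma dvd_const_polyE:
  fixes g :: "'a::idom poly"
  assumes "g dvd [:k:]" "k \<noteq> 0"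
  obtains g0 where "g = [:g0:]"
proof -
  have "degree g \<le> degree [:k:]" using assms by (intro dvd_imp_degree_le) auto
  then show ?thesis using that by (auto elim: degree_eq_zeroE)
qed

lemma coprime_const_poly:
  fixes p q :: "'a::{idom_divide,algebraic_semidom}"
  assumes "coprime p q" "p \<noteq> 0"
  shows "coprime [:p:] [:q:]"
proof (rule coprimeI)
  fix g assume g: "g dvd [:p:]" "g dvd [:q:]"
  obtain g0 where "g = [:g0:]" using g(1) assms(2) by (rule dvd_const_polyE)
  with g assms(1) show "is_unit g"
    by (auto simp: is_unit_const_poly_iff dest: coprime_common_divisor)
qed

text \<open>A divisor of a nonzero constant is constant, so it divides every coefficient of u, one
  of which is a unit. This yields the units with a coefficient 1, such as 1 - a q^j, in later
  lemmas.\<close>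

lemma coprime_primitive_const:
  fixes u :: "'a::{idom_divide,algebraic_semidom} poly"
  assumes "is_unit (coeff u i)" "p \<noteq> 0"
  shows "coprime u [:p:]"
proof (rule coprimeI)
  fix g assume g: "g dvd u" "g dvd [:p:]"
  obtain g0 where g0: "g = [:g0:]" using g(2) assms(2) by (rule dvd_const_polyE)
  then have "g0 dvd coeff u i" using g(1) by (simp add: const_poly_dvd_iff)
  then show "is_unit g" using assms(1) g0 by (auto simp: is_unit_const_poly_iff intro: dvd_trans)
qed

section \<open>Congruence modulo the linear factors\<close>

lemma V_nonzero [simp]: "Vq \<noteq> 0" "Va \<noteq> 0" "Vc \<noteq> 0" "Ve \<noteq> 0"
  by (simp_all add: Vq_def Va_def Vc_def Ve_def)

lemma Vq_power: "Vq ^ j = [:[:[:monom 1 j:]:]:]"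
  by (simp add: Vq_def poly_const_pow monom_altdef)

lemma PhiQ_eq: "PhiQ n = [:[:[:cyclo n:]:]:]"
proof -
  have "poly (map_poly cR p) Vq = [:[:[:p:]:]:]" for p
  proof (induction p)
    case (pCons x p)
    then show ?case by (simp add: map_poly_pCons cR_def Vq_def)
  qed simp
  then show ?thesis by (simp add: PhiQ_def)
qed

lemma punit_emb_const:
  assumes "coprime f p" "f \<noteq> 0"
  shows "punit [:[:p:]:] (emb [:[:f:]:])"
  using assms by (intro punit_emb coprime_const_poly) simp_all

text \<open>The modulus is free of c and e, while these elements are monic and linear in one of
  them.\<close>

lemma punit_emb_ce:
  assumes "p \<noteq> 0"
  shows "punit [:[:p:]:] (emb Vc)" "punit [:[:p:]:] (emb Ve)"
    and "punit [:[:p:]:] (emb Vc - emb Vq ^ j)" "punit [:[:p:]:] (emb Ve - emb Vq ^ j)"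
proof -
  have c: "Vc - Vq ^ j = [:[:[:- monom 1 j:], 1:]:]"
    by (simp add: Vc_def Vq_power one_pCons)
  have e: "Ve - Vq ^ j = [:[:[:- monom 1 j:]:], 1:]"
    by (simp add: Ve_def Vq_power one_pCons)
  have cp: "coprime [:x, 1:] [:p:]" and cp': "coprime [:y, 1:] [:[:p:]:]" for x y
    using assms by (simp_all add: coprime_primitive_const[where i = 1])
  have pc: "punit [:[:p:]:] (emb [:[:x, 1:]:])" for x
    by (intro punit_emb coprime_const_poly cp) simp_all
  have pe: "punit [:[:p:]:] (emb [:x, 1:])" for x
    by (intro punit_emb cp') simp
  show "punit [:[:p:]:] (emb Vc)" "punit [:[:p:]:] (emb Ve)"
    unfolding Vc_def Ve_def by (rule pc pe)+
  show "punit [:[:p:]:] (emb Vc - emb Vq ^ j)" "punit [:[:p:]:] (emb Ve - emb Vq ^ j)"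
    unfolding emb_power[symmetric] emb_simps[symmetric] c e by (rule pc pe)+
qed

lemma one_minus_emb_Vq_power: "1 - emb Vq ^ j = emb [:[:[:1 - monom 1 j:]:]:]"
proof -
  have "1 - Vq ^ j = [:[:[:1 - monom 1 j:]:]:]" by (simp add: Vq_power one_pCons)
  then show ?thesis by (simp only: emb_simps[symmetric] emb_power[symmetric])
qed

lemma emb_Vq_power_diff: "emb Vq ^ i - emb Vq ^ j = emb [:[:[:monom 1 i - monom 1 j:]:]:]"
  unfolding emb_simps[symmetric] emb_power[symmetric] by (simp add: Vq_power)

lemma emb_Vq_power_eq_iff: "emb Vq ^ i = emb Vq ^ j \<longleftrightarrow> i = j"
  unfolding emb_power[symmetric] by (simp add: Vq_power monom_eq_iff')

locale wp_params =
  fixes n d m :: nat and r :: int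
  assumes n: "1 < n" and d: "2 \<le> d" and r: "r = 1 \<or> r = - 1" and nm: "int n = int d * int m + r"
begin

abbreviation q :: rfun4 where "q \<equiv> emb Vq"
abbreviation a :: rfun4 where "a \<equiv> emb Va"
abbreviation c :: rfun4 where "c \<equiv> emb Vc"
abbreviation e :: rfun4 where "e \<equiv> emb Ve"
abbreviation D :: rfun4 where "D \<equiv> emb Vq ^ d"
abbreviation \<alpha> :: rfun4 where "\<alpha> \<equiv> emb Vq powi r"
abbreviation z :: rfun4 where "z \<equiv> emb Vq ^ n"

definition lhs :: "rfun4 \<Rightarrow> rfun4" where
  "lhs x = (\<Sum>k\<le>m. vwp D \<alpha> x c e k * (qpoch \<alpha> D k / qpoch D D k)) / (1 - q)"

text \<open>The power q^(r(r-n)/d) is \<alpha>^-m, as n - r = d m. The argument x makes it possible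
  to replace a by z or 1/z.\<close>

definition Qa :: "rfun4 \<Rightarrow> rfun4" where
  "Qa x = (1 - x * z) * (x - z) / (1 - x)\<^sup>2 / \<alpha> ^ m
     * (1 / qpoch D D m - qpoch D D m / (qpoch (D / x) D m * qpoch (x * D) D m))
     + 1 / (\<alpha> ^ m * qpoch D D m)"

definition rhs :: "rfun4 \<Rightarrow> rfun4" where
  "rhs x = (1 - z) / (1 - q) * Qa x * balsum D \<alpha> x c e m 1"

lemma m_less_n: "m < n"
proof -
  have "2 * int m \<le> int d * int m" using d by (intro mult_right_mono) auto
  then show ?thesis using n r nm by auto
qed

lemma coprime_nd: "coprime n d"
proof (rule coprimeI)
  fix g assume "g dvd n" "g dvd d"
  then have "int g dvd int n" "int g dvd int d * int m" by (simp_all add: dvd_mult2)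
  then have "int g dvd int n - int d * int m" by (rule dvd_diff)
  then have "int g dvd r" by (simp add: nm)
  then have "int g dvd 1" using r by auto
  then show "is_unit g" by simp
qed

text \<open>n is coprime to d and i + 1 < n. This makes (D;D)_m a unit modulo Phi_n.\<close>

lemma not_n_dvd: "i < m \<Longrightarrow> \<not> n dvd d * Suc i"
proof
  assume i: "i < m" and "n dvd d * Suc i"
  then have "n dvd Suc i" using coprime_nd by (simp add: coprime_dvd_mult_right_iff del: mult_Suc_right)
  then have "n \<le> Suc i" by (rule dvd_imp_le) simp
  then show False using i m_less_n by simp
qed

text \<open>Keeps the factors z - D^(i+1) of (D/z;D)_k from vanishing.\<close>

lemma n_neq: "n \<noteq> d * Suc i"
proof
  assume "n = d * Suc i"
  then have "d dvd n" by simp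
  then have "is_unit d" using coprime_nd by (simp add: coprime_absorb_right)
  then show False using d by simp
qed

lemma z_eq: "z = \<alpha> * D ^ m"
proof -
  have "z = q powi int n" by simp
  also have "int n = r + int (d * m)" using nm by simp
  also have "q powi \<dots> = \<alpha> * q powi int (d * m)" by (simp add: power_int_add)
  finally show ?thesis by (simp only: power_int_of_nat power_mult)
qed

lemma D_Suc: "D * D ^ i = q ^ (d * Suc i)"
  by (simp add: power_mult power_add)

lemma \<alpha>D_nonzero: "qpoch (\<alpha> * D) D k \<noteq> 0"
proof (rule qpoch_nonzero[of k])
  fix i
  let ?j = "r + int (d * Suc i)"
  have "d \<le> d * Suc i" by simp
  then have j: "0 < ?j" using d r by linarith
  have "\<alpha> * D * D ^ i = \<alpha> * q powi int (d * Suc i)"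
    unfolding power_int_of_nat D_Suc[symmetric] by (simp only: mult.assoc)
  also have "\<dots> = q powi ?j" by (simp add: power_int_add)
  also have "\<dots> = q ^ nat ?j" using j by (simp add: power_int_def)
  finally have "\<alpha> * D * D ^ i = q ^ nat ?j" .
  moreover have "q ^ nat ?j \<noteq> q ^ 0" using j unfolding emb_Vq_power_eq_iff by simp
  ultimately show "\<alpha> * D * D ^ i \<noteq> 1" by simp
qed simp

end

text \<open>What the three moduli have in common. Conditions on a are left to
  \<open>wp_cyclo\<close>: modulo a linear factor a is tied to z or 1/z.\<close>

locale wp_modulus = wp_params +
  fixes P :: mpoly4
  assumes nonunit: "\<not> is_unit P"
    and uq: "punit P (emb Vq)" and uc: "punit P (emb Vc)" and ue: "punit P (emb Ve)"
    and u1q: "punit P (1 - emb Vq)"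
    and ucq: "\<And>j. punit P (emb Vc - emb Vq ^ j)" and ueq: "\<And>j. punit P (emb Ve - emb Vq ^ j)"
    and uqq: "\<And>i. i < m \<Longrightarrow> punit P (1 - emb Vq ^ (d * Suc i))"
begin

lemma uD: "punit P D" and u\<alpha>: "punit P \<alpha>" and uz: "punit P z"
  by (intro punit_power punit_powi uq)+

lemma u_qpoch_D: "k \<le> m \<Longrightarrow> punit P (qpoch D D k)"
  by (rule punit_qpoch) (simp only: D_Suc, rule uqq, simp)

lemma u_qpoch_div:
  assumes "punit P x" "\<And>j. punit P (x - q ^ (d * Suc j))"
  shows "punit P (qpoch (D / x) D k)"
proof (rule punit_qpoch)
  fix i
  have "1 - D / x * D ^ i = (x - q ^ (d * Suc i)) / x"
    using punit_nonzero[OF assms(1)] unfolding D_Suc[symmetric] by (simp add: field_simps)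
  then show "punit P (1 - D / x * D ^ i)"
    using assms by (simp only: punit_divide)
qed

lemma u_qpoch_mult:
  assumes "\<And>j. punit P (1 - x * q ^ (d * Suc j))"
  shows "punit P (qpoch (x * D) D k)"
  by (rule punit_qpoch) (simp only: mult.assoc D_Suc assms)

lemmas pints = uD u\<alpha> uz uc ue uq

lemma pcong_consts: "pcong P D D" "pcong P \<alpha> \<alpha>" "pcong P z z" "pcong P c c" "pcong P e e" "pcong P 1 1"
  by (intro pcong_refl punit_imp_pint pints pint_1)+

lemma pcong_qpoch': "pcong P x y \<Longrightarrow> pcong P (qpoch x D k) (qpoch y D k)"
  by (erule pcong_qpoch) (rule punit_imp_pint[OF uD])

lemma pcong_div: "pcong P x y \<Longrightarrow> pcong P u v \<Longrightarrow> punit P v \<Longrightarrow> pcong P (x / u) (y / v)"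
  by (rule pcong_divide[OF _ _ _ nonunit])

lemma pcong_vwp:
  assumes "pcong P x y" "punit P y" "punit P (qpoch (D / y) D k)" "punit P (qpoch (y * D) D k)" "k \<le> m"
  shows "pcong P (vwp D \<alpha> x c e k) (vwp D \<alpha> y c e k)"
  unfolding vwp_def
  by (intro pcong_mult pcong_div pcong_power pcong_diff pcong_qpoch' pcong_consts assms
      punit_mult punit_power u_qpoch_D u_qpoch_div uc ue ucq ueq u\<alpha>)

lemma pcong_balsum:
  assumes "pcong P x y" "punit P y" "pcong P s t" "punit P t"
  shows "pcong P (balsum D \<alpha> x c e m s) (balsum D \<alpha> y c e m t)"
  unfolding balsum_def
  by (intro pcong_sum pcong_mult pcong_div pcong_power pcong_diff pcong_qpoch' pcong_consts assms
      punit_mult punit_power u_qpoch_D u_qpoch_div uc ue ucq ueq u\<alpha>) simp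

lemma pcong_lhs:
  assumes "pcong P x y" "punit P y" "\<And>k. punit P (qpoch (D / y) D k)" "\<And>k. punit P (qpoch (y * D) D k)"
  shows "pcong P (lhs x) (lhs y)"
  unfolding lhs_def
  by (intro pcong_div pcong_sum pcong_mult pcong_vwp pcong_qpoch' pcong_consts pcong_diff
      pcong_refl[OF punit_imp_pint[OF uq]] u1q u_qpoch_D assms) simp_all

lemma pcong_Qa:
  assumes "pcong P x y" "punit P y" "punit P (1 - y)" "punit P (qpoch (D / y) D m)" "punit P (qpoch (y * D) D m)"
  shows "pcong P (Qa x) (Qa y)"
  unfolding Qa_def
  by (intro pcong_div pcong_add pcong_sum pcong_mult pcong_qpoch' pcong_consts pcong_diff pcong_power
      punit_mult punit_power u_qpoch_D assms u\<alpha>) simp_all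

lemma pcong_rhs:
  assumes "pcong P x y" "punit P y" "punit P (1 - y)" "punit P (qpoch (D / y) D m)" "punit P (qpoch (y * D) D m)"
  shows "pcong P (rhs x) (rhs y)"
  unfolding rhs_def
  by (intro pcong_div pcong_mult pcong_consts pcong_diff pcong_Qa pcong_balsum
      pcong_refl[OF punit_imp_pint[OF uq]] u1q assms punit_1)

text \<open>At y = z or y = 1/z the product (1 - yz)(y - z) vanishes and \<open>Qa\<close> shrinks
  to its last term. The two sides at y are then equal by
  \<open>vwp_sum_terminating_a\<close>.\<close>

lemma pdiv_specialise:
  assumes "pcong P a y" "y = z \<or> y = 1 / z" and "punit P (1 - z)"
    and "punit P (qpoch (D / z) D m)"
    and "\<And>k. punit P (qpoch (D / y) D k)" "\<And>k. punit P (qpoch (y * D) D k)"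
  shows "pdiv P (lhs a - rhs a)"
proof -
  have uy: "punit P y" using assms(2) uz by (auto intro: punit_inverse)
  have u1y: "punit P (1 - y)"
    using assms(2)
  proof
    assume "y = 1 / z"
    then have "1 - y = - ((1 - z) / z)" by (simp add: field_simps)
    then show ?thesis using punit_minus[OF punit_divide[OF assms(3) uz]] by simp
  qed (use assms(3) in simp)
  have zero: "(1 - y * z) * (y - z) = 0" using assms(2) by auto
  have "Qa y = 1 / (\<alpha> ^ m * qpoch D D m)"
    unfolding Qa_def zero by simp
  then have "rhs y = (1 - z) / (\<alpha> ^ m * qpoch D D m) * balsum D \<alpha> y c e m 1 / (1 - q)"
    by (simp add: rhs_def)
  also have "(1 - z) / (\<alpha> ^ m * qpoch D D m) * balsum D \<alpha> y c e m 1
      = (\<Sum>k\<le>m. vwp D \<alpha> y c e k * (qpoch \<alpha> D k / qpoch D D k))"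
    by (rule vwp_sum_terminating_a[symmetric, OF _ _ _ _ z_eq assms(2)])
      (simp_all add: \<alpha>D_nonzero punit_nonzero[OF u_qpoch_D] punit_nonzero[OF assms(4)]
        punit_nonzero[OF u_qpoch_div[OF uc ucq]] punit_nonzero[OF u_qpoch_div[OF ue ueq]] power_int_eq_0_iff)
  finally have eq: "rhs y = lhs y" by (simp add: lhs_def)
  have "pcong P (lhs a) (lhs y)" by (rule pcong_lhs) (use assms uy in simp_all)
  moreover have "pcong P (rhs a) (lhs y)"
    unfolding eq[symmetric] by (rule pcong_rhs) (use assms uy u1y in simp_all)
  ultimately have "pcong P (lhs a) (rhs a)" by (blast intro: pcong_trans pcong_sym)
  then show ?thesis by (simp add: pcong_def)
qed

end

context wp_params
begin

text \<open>As polynomials in a, 1 - az has constant coefficient 1 and a - z has leading coefficient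
  1. Hence every nonzero polynomial in q alone is a unit modulo either.\<close>

lemma wp_modulus_linear:
  assumes "coeff p 0 = 1 \<or> coeff p 1 = 1" "degree p = 1"
  shows "wp_modulus n d m r [:[:p:]:]"
    and "f \<noteq> 0 \<Longrightarrow> punit [:[:p:]:] (emb [:[:[:f:]:]:])"
proof -
  have p0: "p \<noteq> 0" using assms(2) by auto
  show u: "punit [:[:p:]:] (emb [:[:[:f:]:]:])" if "f \<noteq> 0" for f
  proof -
    have "coprime p [:f:]"
      using assms(1) that by (metis coprime_primitive_const dvd_refl)
    then show ?thesis using that by (intro punit_emb_const) (simp_all add: coprime_commute)
  qed
  show "wp_modulus n d m r [:[:p:]:]"
  proof
    show "\<not> is_unit [:[:p:]:]"
      using assms(2) by (auto simp: is_unit_const_poly_iff is_unit_poly_iff)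
    have "emb Vq = emb [:[:[:monom 1 1:]:]:]" using Vq_power[of 1] by simp
    then show "punit [:[:p:]:] (emb Vq)" using u[of "monom 1 1"] by simp
    have nz: "1 - monom (1::rat) j \<noteq> 0" if "0 < j" for j
      using xpow1_nonzero[OF that] by simp
    show "punit [:[:p:]:] (1 - emb Vq)"
      using u[OF nz[of 1]] one_minus_emb_Vq_power[of 1] by simp
    show "punit [:[:p:]:] (1 - emb Vq ^ (d * Suc i))" for i
      unfolding one_minus_emb_Vq_power by (rule u[OF nz]) (use d in simp)
  qed (use p0 in \<open>auto intro: punit_emb_ce\<close>)
qed

lemma pdiv_linear:
  assumes "coeff p 0 = 1 \<or> coeff p 1 = 1" "degree p = 1"
    and cong: "pcong [:[:p:]:] a y" and y: "y = z \<or> y = 1 / z"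
  shows "pdiv [:[:p:]:] (lhs a - rhs a)"
proof -
  let ?P = "[:[:p:]:]"
  interpret wp_modulus n d m r ?P by (rule wp_modulus_linear[OF assms(1,2)])
  note u = wp_modulus_linear(2)[OF assms(1,2)]
  have ud: "punit ?P (q ^ i - q ^ j)" if "i \<noteq> j" for i j
    unfolding emb_Vq_power_diff by (rule u) (use that in \<open>simp add: monom_eq_iff'\<close>)
  have u1: "punit ?P (1 - q ^ j)" if "0 < j" for j
    using ud[of 0 j] that by simp
  have 1: "punit ?P (qpoch (D / z) D k)" for k
    by (rule u_qpoch_div[OF uz ud[OF n_neq]])
  moreover have "punit ?P (qpoch (z * D) D k)" for k
    by (rule u_qpoch_mult) (unfold power_add[symmetric], rule u1, use n in simp)
  ultimately have 1: "punit ?P (qpoch (D / z) D k)" "punit ?P (qpoch (z * D) D k)" for k .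
  have "D / (1 / z) = z * D" "1 / z * D = D / z" by simp_all
  then have 2: "punit ?P (qpoch (D / y) D k)" "punit ?P (qpoch (y * D) D k)" for k
    using y 1 by (auto simp: mult.commute)
  show ?thesis
    by (rule pdiv_specialise[OF cong y _ 1(1) 2]) (use u1 n in simp)
qed

end

section \<open>Congruence modulo the square of the cyclotomic polynomial\<close>

text \<open>A discrete product rule: the second difference of a product expands into terms
  containing either the second difference of one factor or two first differences, each a multiple of
  P.\<close>

lemma pdiv_power2_prod_diff:
  fixes m :: nat
  assumes "\<And>i. i < m \<Longrightarrow> pcong P (s i) (t i)" "\<And>i. i < m \<Longrightarrow> pcong P (s i) (s' i)"
    and "\<And>i. i < m \<Longrightarrow> pcong P (t i) (t' i)"
    and "\<And>i. i < m \<Longrightarrow> pdiv (P\<^sup>2) ((s i - s' i) - (t i - t' i))"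
  shows "pdiv (P\<^sup>2) ((prod s {..<m} - prod s' {..<m}) - (prod t {..<m} - prod t' {..<m}))"
  using assms
proof (induction m)
  case (Suc m)
  let ?S = "prod s {..<m}" and ?S' = "prod s' {..<m}" and ?T = "prod t {..<m}" and ?T' = "prod t' {..<m}"
  have IH: "pdiv (P\<^sup>2) ((?S - ?S') - (?T - ?T'))"
    by (rule Suc.IH) (use Suc.prems in auto)
  have ST: "pcong P ?S ?T" "pcong P ?S ?S'" "pcong P ?T ?T'"
    by (rule pcong_prod; use Suc.prems in auto)+
  have m: "pcong P (s m) (t m)" "pcong P (s m) (s' m)" "pcong P (t m) (t' m)"
    "pdiv (P\<^sup>2) ((s m - s' m) - (t m - t' m))" using Suc.prems by auto
  have "pcong P (s' m) (t' m)" using m by (blast intro: pcong_trans pcong_sym)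
  then have "pdiv (P\<^sup>2) (((s m - s' m) - (t m - t' m)) * ?S + (t m - t' m) * (?S - ?T)
      + s' m * ((?S - ?S') - (?T - ?T')) + (s' m - t' m) * (?T - ?T'))"
    using m ST IH unfolding pcong_def
    by (intro pdiv_add pdiv_mult pdiv_mult' pdiv_mult_pdiv) (simp_all add: pint_power2)
  also have "((s m - s' m) - (t m - t' m)) * ?S + (t m - t' m) * (?S - ?T)
      + s' m * ((?S - ?S') - (?T - ?T')) + (s' m - t' m) * (?T - ?T')
     = (prod s {..<Suc m} - prod s' {..<Suc m}) - (prod t {..<Suc m} - prod t' {..<Suc m})"
    by (simp add: algebra_simps)
  finally show ?case .
qed simp

text \<open>Pairing k with m - k counts every term twice, and the factor 2 has to be
  removed.\<close>

lemma pint_half: "pint P (1 / 2)"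
proof -
  have "cR (1 / 2) + cR (1 / 2) = 1"
    by (simp add: cR_def one_pCons)
  then have "emb (cR (1 / 2)) + emb (cR (1 / 2)) = 1"
    by (metis emb_simps(1,5))
  then have "2 * emb (cR (1 / 2)) = 1"
    by (simp only: mult_2)
  then have "1 / 2 = emb (cR (1 / 2))"
    by (metis divide_eq_eq mult.commute mult_zero_left zero_neq_one)
  then show ?thesis by (simp only: pint_emb)
qed

lemma sum_atMost_symmetrise:
  fixes f :: "nat \<Rightarrow> 'a::comm_ring_1"
  shows "2 * sum f {..m} = (\<Sum>k\<le>m. f k + f (m - k))"
proof -
  have "(\<Sum>k\<le>m. f (m - k)) = sum f {..m}"
    by (rule sum.reindex_bij_witness[of _ "\<lambda>k. m - k" "\<lambda>k. m - k"]) auto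
  then show ?thesis by (simp only: sum.distrib mult_2)
qed

locale wp_cyclo = wp_modulus +
  assumes z1: "pcong P (emb Vq ^ n) 1"
    and ua: "punit P (emb Va)" and u1a: "punit P (1 - emb Va)"
    and uaq: "\<And>j. punit P (emb Va - emb Vq ^ j)" and u1aq: "\<And>j. punit P (1 - emb Va * emb Vq ^ j)"
begin

lemma u_upper:
  assumes "x \<in> {1, c, e, a, 1 / a}"
  shows "punit P x" and "k \<le> m \<Longrightarrow> punit P (qpoch (D / x) D k)"
proof -
  show ux: "punit P x"
    using assms uc ue ua punit_inverse[OF ua] punit_1 by auto
  assume k: "k \<le> m"
  have "D / (1 / a) = a * D" by simp
  then show "punit P (qpoch (D / x) D k)"
    using assms u_qpoch_D[OF k] u_qpoch_div[OF uc ucq] u_qpoch_div[OF ue ueq] u_qpoch_div[OF ua uaq]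
      u_qpoch_mult[OF u1aq] by (auto simp: mult.commute)
qed

lemma pcong_div_z:
  assumes "punit P x" "pint P y"
  shows "pcong P (y / (x * z)) (y / x)"
  using pcong_div[OF pcong_refl[OF assms(2)] pcong_mult[OF pcong_refl[OF punit_imp_pint[OF assms(1)]] z1]] assms(1)
  by simp

lemma pcong_wpr:
  assumes x: "x \<in> {1, c, e, a, 1 / a}" and k: "k \<le> m"
  shows "pcong P (wpr D \<alpha> m z k x) (qpoch (x * \<alpha>) D k / qpoch (D / x) D k)"
proof -
  note ux = u_upper(1)[OF x]
  have 1: "pcong P (D / (x * z)) (D / x)"
    by (rule pcong_div_z[OF ux punit_imp_pint[OF uD]])
  have "pint P (x * \<alpha>)" by (intro pint_mult punit_imp_pint ux u\<alpha>)
  then have 2: "pcong P (x * \<alpha> / z) (x * \<alpha>)"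
    using pcong_div_z[OF punit_1] by simp
  have "pcong P (wpr D \<alpha> m z k x)
      (qpoch (D / x) D m / qpoch (D / x) D m * (qpoch (x * \<alpha>) D k / qpoch (D / x) D k))"
    unfolding wpr_def
    by (intro pcong_mult pcong_div pcong_qpoch' 1 2 u_upper(2)[OF x] k order_refl
       pcong_refl[OF punit_imp_pint[OF u_upper(2)[OF x]]])
  then show ?thesis
    using punit_nonzero[OF u_upper(2)[OF x order_refl]] by simp
qed

text \<open>The factor that reversal puts in front of \<open>cleared'\<close> in
  \<open>cleared_reflect\<close>.\<close>

definition w :: "nat \<Rightarrow> rfun4" where
  "w k = (- 1) ^ m * (D / \<alpha>) ^ k / (D ^ m * tri D m)"

lemma pint_w: "pint P (w k)"
proof -
  have "punit P (tri D m)"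
    unfolding tri_def by (induction m) (simp_all add: punit_mult punit_power uD)
  then have "punit P (w k)"
    unfolding w_def
    by (intro punit_divide punit_mult punit_power uD u\<alpha> punit_minus punit_1)
  then show ?thesis by (rule punit_imp_pint)
qed

lemma pint_g: "pint P ((D\<^sup>2 / (\<alpha> ^ 3 * c * e)) ^ k)"
  by (intro punit_imp_pint punit_power punit_divide punit_mult uD u\<alpha> uc ue)

lemma pint_vwp: "k \<le> m \<Longrightarrow> pint P (vwp D \<alpha> a c e k)"
  using pcong_vwp[OF pcong_refl[OF punit_imp_pint[OF ua]] ua, of k]
    u_qpoch_div[OF ua uaq] u_qpoch_mult[OF u1aq] by (simp add: pcong_def)

text \<open>Put z = 1 in \<open>vwp_reflect\<close>: each \<open>wpr\<close> becomes the quotient at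
  k, and \<alpha>D^(2k) - z^2 becomes -(1 - \<alpha>D^(2k)).\<close>

lemma vwp_antisymmetric:
  assumes k: "k \<le> m"
  shows "pdiv P (vwp D \<alpha> a c e k + vwp D \<alpha> a c e (m - k) * w k)"
proof -
  let ?R = "\<lambda>x. qpoch (x * \<alpha>) D k / qpoch (D / x) D k"
  have "vwp D \<alpha> a c e (m - k) * w k
         = z ^ (2 * m) / z * (\<alpha> * D ^ (2 * k) - z\<^sup>2)
           * (wpr D \<alpha> m z k 1 * wpr D \<alpha> m z k c * wpr D \<alpha> m z k e * wpr D \<alpha> m z k a * wpr D \<alpha> m z k (1 / a))
           * (D\<^sup>2 / (\<alpha> ^ 3 * c * e)) ^ k"
    unfolding w_def
  proof (rule vwp_reflect[OF _ _ _ _ _ z_eq k])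
    fix x assume x: "x \<in> {1, c, e, a, 1 / a}"
    have "pcong P (qpoch (D / (x * z)) D m) (qpoch (D / x) D m)"
      by (intro pcong_qpoch' pcong_div_z u_upper(1)[OF x] punit_imp_pint[OF uD])
    then have "punit P (qpoch (D / (x * z)) D m)"
      using u_upper(2)[OF x order_refl] nonunit by (rule pcong_punit)
    then show "qpoch (D / x) D m \<noteq> 0 \<and> qpoch (D / (x * z)) D m \<noteq> 0"
      using u_upper(2)[OF x order_refl] punit_nonzero by blast
  qed (simp_all add: power_int_eq_0_iff)
  moreover have "pcong P (z ^ (2 * m) / z * (\<alpha> * D ^ (2 * k) - z\<^sup>2)
           * (wpr D \<alpha> m z k 1 * wpr D \<alpha> m z k c * wpr D \<alpha> m z k e * wpr D \<alpha> m z k a * wpr D \<alpha> m z k (1 / a))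
           * (D\<^sup>2 / (\<alpha> ^ 3 * c * e)) ^ k)
        (1 ^ (2 * m) / 1 * (\<alpha> * D ^ (2 * k) - 1\<^sup>2) * (?R 1 * ?R c * ?R e * ?R a * ?R (1 / a)) * (D\<^sup>2 / (\<alpha> ^ 3 * c * e)) ^ k)"
    by (intro pcong_mult pcong_div pcong_diff pcong_power pcong_consts z1 pcong_wpr k punit_1 pcong_refl[OF pint_g]) simp_all
  moreover have "1 ^ (2 * m) / 1 * (\<alpha> * D ^ (2 * k) - 1\<^sup>2) * (?R 1 * ?R c * ?R e * ?R a * ?R (1 / a)) * (D\<^sup>2 / (\<alpha> ^ 3 * c * e)) ^ k
      = - vwp D \<alpha> a c e k"
  proof -
    define Y where "Y = 1 - \<alpha> * D ^ (2 * k)"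
    have minus: "\<alpha> * D ^ (2 * k) - 1\<^sup>2 = - Y" by (simp add: Y_def)
    show ?thesis unfolding vwp_def minus Y_def[symmetric] by (simp add: mult_ac)
  qed
  ultimately have "pcong P (vwp D \<alpha> a c e (m - k) * w k) (- vwp D \<alpha> a c e k)"
    by (simp only:)
  then show ?thesis
    by (simp add: pcong_def add.commute)
qed

abbreviation "B \<equiv> cleared D \<alpha> m"
abbreviation "C \<equiv> cleared' D \<alpha> z m"

lemma pcong_cleared: "pcong P (B k 1) (B k z)" "pcong P (B k z) (C k z)"
  and pdiv_cleared_diff: "pdiv (P\<^sup>2) ((B k 1 - B k z) - (C k 1 - C k z))"
proof -
  let ?s = "\<lambda>b i. if i < k then b - \<alpha> * D ^ i else 1 - b * D ^ Suc i"
  let ?t = "\<lambda>b i. if i < k then b * z - \<alpha> * D ^ i else z - b * D ^ Suc i"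
  have 1: "pcong P 1 z" by (rule pcong_sym[OF z1])
  have zz: "pcong P z (z * z)" using pcong_mult[OF pcong_consts(3) 1] by simp
  have y: "pcong P (\<alpha> * D ^ i) (\<alpha> * D ^ i)" for i
    by (intro pcong_mult pcong_power pcong_consts)
  have x: "pcong P (1 * D ^ i) (z * D ^ i)" "pcong P (z * D ^ i) (z * D ^ i)" for i
    by (intro pcong_mult pcong_power pcong_consts 1)+
  have s: "pcong P (?s 1 i) (?s z i)" for i
    using pcong_diff[OF 1 y] pcong_diff[OF pcong_consts(6) x(1)[of "Suc i"]] by (simp del: power_Suc)
  have t: "pcong P (?t 1 i) (?t z i)" for i
    using pcong_diff[OF zz y] pcong_diff[OF pcong_consts(3) x(1)[of "Suc i"]] by (simp del: power_Suc)
  have st: "pcong P (?s z i) (?t z i)" for i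
    using pcong_diff[OF pcong_consts(3) y] pcong_diff[OF zz y] pcong_diff[OF 1 x(2)[of "Suc i"]] by (simp del: power_Suc)
  have st1: "pcong P (?s 1 i) (?t 1 i)" for i
    using s t st by (blast intro: pcong_trans pcong_sym)
  \<comment> \<open>For i < k the second difference is (1 - z) - (z - z^2) = (1 - z)^2; for the
    other factors it is 0.\<close>
  have diff: "pdiv (P\<^sup>2) ((?s 1 i - ?s z i) - (?t 1 i - ?t z i))" for i
  proof (cases "i < k")
    case True
    have "pdiv (P\<^sup>2) ((1 - z) * (1 - z))"
      using 1 by (intro pdiv_mult_pdiv) (simp_all add: pcong_def)
    then show ?thesis using True by (simp add: algebra_simps)
  qed simp
  show "pcong P (B k 1) (B k z)" "pcong P (B k z) (C k z)"
    unfolding cleared_def cleared'_def by (intro pcong_prod s st)+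
  show "pdiv (P\<^sup>2) ((B k 1 - B k z) - (C k 1 - C k z))"
    unfolding cleared_def cleared'_def by (rule pdiv_power2_prod_diff) (rule st1 s t diff)+
qed

text \<open>The deformed sum multiplied by (bD;D)_m, see \<open>sum_conv_T\<close>, so that b enters
  polynomially.\<close>

definition T :: "rfun4 \<Rightarrow> rfun4" where
  "T b = (\<Sum>k\<le>m. vwp D \<alpha> a c e k * B k b)"

lemma cleared_m: "k \<le> m \<Longrightarrow> B (m - k) b = w k * C k b"
  unfolding w_def by (rule cleared_reflect[OF _ _ z_eq]) (simp_all add: power_int_eq_0_iff)

lemma halve_pdiv: "pdiv M (2 * x) \<Longrightarrow> pdiv M x"
  using pdiv_mult[OF _ pint_half, of M "2 * x"] by simp

text \<open>Since B (m - k) = w k * C k and C is congruent to B, the terms k and m - k add up to a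
  multiple of the sum in \<open>vwp_antisymmetric\<close>.\<close>

lemma pdiv_T: "pdiv P (T z)"
proof (rule halve_pdiv)
  have "2 * T z = (\<Sum>k\<le>m. vwp D \<alpha> a c e k * B k z + vwp D \<alpha> a c e (m - k) * B (m - k) z)"
    unfolding T_def by (rule sum_atMost_symmetrise)
  also have "\<dots> = (\<Sum>k\<le>m. (vwp D \<alpha> a c e k + vwp D \<alpha> a c e (m - k) * w k) * B k z
      - vwp D \<alpha> a c e (m - k) * w k * (B k z - C k z))"
  proof -
    have "x * b + y * (v * c) = (x + y * v) * b - y * v * (b - c)" for x b y v c :: rfun4
      by (simp add: algebra_simps)
    then show ?thesis by (intro sum.cong refl) (simp only: atMost_iff cleared_m)
  qed
  also have "pdiv P \<dots>"
  proof (rule pdiv_sum, rule pdiv_diff)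
    fix k assume "k \<in> {..m}"
    then have k: "k \<le> m" by simp
    have BC: "pint P (B k z)" "pdiv P (B k z - C k z)" using pcong_cleared(2) by (simp_all add: pcong_def)
    show "pdiv P ((vwp D \<alpha> a c e k + vwp D \<alpha> a c e (m - k) * w k) * B k z)"
      by (rule pdiv_mult[OF vwp_antisymmetric[OF k] BC(1)])
    show "pdiv P (vwp D \<alpha> a c e (m - k) * w k * (B k z - C k z))"
      by (rule pdiv_mult'[OF pint_mult[OF pint_vwp pint_w] BC(2)]) simp
  qed
  finally show "pdiv P (2 * T z)" .
qed

text \<open>Each pair splits in two: the antisymmetric sum times the change of B, a product of two
  multiples of P, and a multiple of the discrepancy between the changes of B and C, which P^2
  divides.\<close>

lemma pdiv_power2_T_diff: "pdiv (P\<^sup>2) (T 1 - T z)"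
proof (rule halve_pdiv)
  have "2 * (T 1 - T z) = (\<Sum>k\<le>m. (vwp D \<alpha> a c e k * B k 1 + vwp D \<alpha> a c e (m - k) * B (m - k) 1)
     - (vwp D \<alpha> a c e k * B k z + vwp D \<alpha> a c e (m - k) * B (m - k) z))"
    unfolding T_def right_diff_distrib sum_atMost_symmetrise sum_subtractf ..
  also have "\<dots> = (\<Sum>k\<le>m. (vwp D \<alpha> a c e k + vwp D \<alpha> a c e (m - k) * w k) * (B k 1 - B k z)
      - vwp D \<alpha> a c e (m - k) * w k * ((B k 1 - B k z) - (C k 1 - C k z)))"
  proof -
    have "(x * b + y * (v * c)) - (x * b' + y * (v * c')) = (x + y * v) * (b - b') - y * v * ((b - b') - (c - c'))"
      for x b b' y v c c' :: rfun4
      by (simp add: algebra_simps)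
    then show ?thesis by (intro sum.cong refl) (simp only: atMost_iff cleared_m)
  qed
  also have "pdiv (P\<^sup>2) \<dots>"
  proof (rule pdiv_sum, rule pdiv_diff)
    fix k assume "k \<in> {..m}"
    then have k: "k \<le> m" by simp
    have "pdiv P (B k 1 - B k z)" using pcong_cleared(1) by (simp add: pcong_def)
    then show "pdiv (P\<^sup>2) ((vwp D \<alpha> a c e k + vwp D \<alpha> a c e (m - k) * w k) * (B k 1 - B k z))"
      by (rule pdiv_mult_pdiv[OF vwp_antisymmetric[OF k]])
    have "pint P (vwp D \<alpha> a c e (m - k) * w k)"
      by (intro pint_mult pint_vwp pint_w) simp
    then show "pdiv (P\<^sup>2) (vwp D \<alpha> a c e (m - k) * w k * ((B k 1 - B k z) - (C k 1 - C k z)))"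
      by (intro pdiv_mult' pdiv_cleared_diff) (simp add: pint_power2)
  qed
  finally show "pdiv (P\<^sup>2) (2 * (T 1 - T z))" .
qed

lemma punit_power2: "punit P x \<Longrightarrow> punit (P\<^sup>2) x"
  unfolding punit_def by simp

lemma sum_conv_T:
  assumes "punit P (qpoch (b * D) D m)"
  shows "(\<Sum>k\<le>m. vwp D \<alpha> a c e k * ((\<Prod>i<k. b - \<alpha> * D ^ i) / qpoch (b * D) D k)) = T b / qpoch (b * D) D m"
  unfolding T_def sum_divide_distrib
proof (intro sum.cong refl)
  fix k assume "k \<in> {..m}"
  then have k: "k \<le> m" by simp
  have nz: "qpoch (b * D) D m \<noteq> 0" using assms by (rule punit_nonzero)
  then have "qpoch (b * D) D k \<noteq> 0" using k by (rule qpoch_nonzeroD)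
  with nz have "(\<Prod>i<k. b - \<alpha> * D ^ i) / qpoch (b * D) D k = B k b / qpoch (b * D) D m"
    using cleared_conv_qpoch[OF k, of D \<alpha> b] by (simp add: frac_eq_eq mult_ac)
  then show "vwp D \<alpha> a c e k * ((\<Prod>i<k. b - \<alpha> * D ^ i) / qpoch (b * D) D k) = vwp D \<alpha> a c e k * B k b / qpoch (b * D) D m"
    by simp
qed

lemma pdiv_power2: "pdiv (P\<^sup>2) (lhs a - rhs a)"
proof -
  define M1 Mz where "M1 = qpoch D D m" and "Mz = qpoch (z * D) D m"
  let ?X = "qpoch (D / a) D m * qpoch (a * D) D m"
  have uM1: "punit P M1" unfolding M1_def by (rule u_qpoch_D) simp
  have cM: "pcong P Mz M1"
    using pcong_qpoch'[OF pcong_mult[OF z1 pcong_consts(1)], of m] by (simp add: M1_def Mz_def)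
  then have uMz: "punit P Mz" using uM1 nonunit by (rule pcong_punit)
  have uX: "punit P ?X"
    by (intro punit_mult u_qpoch_div[OF ua uaq] u_qpoch_mult[OF u1aq])
  have 1: "lhs a = T 1 / M1 / (1 - q)"
    using sum_conv_T[of 1] uM1 by (simp add: lhs_def qpoch_def[of \<alpha>] M1_def)
  define V where "V = (z / \<alpha>) ^ m * qpoch (D / z) D m / ?X * balsum D \<alpha> a c e m z"
  have 2: "T z / Mz = (1 - z) * V"
  proof -
    have "(\<Sum>k\<le>m. vwp D \<alpha> a c e k * ((\<Prod>i<k. z - \<alpha> * D ^ i) / qpoch (z * D) D k))
         = (1 - z) * (z / \<alpha>) ^ m * qpoch (D / z) D m / ?X * balsum D \<alpha> a c e m z"
      by (rule vwp_sum_terminating_b[OF _ _ _ _ _ z_eq])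
       (simp_all add: power_int_eq_0_iff punit_nonzero[OF u_qpoch_D] punit_nonzero[OF u_qpoch_div[OF uc ucq]]
         punit_nonzero[OF u_qpoch_div[OF ue ueq]] punit_nonzero[OF u_qpoch_div[OF ua uaq]]
         punit_nonzero[OF u_qpoch_mult[OF u1aq]] \<alpha>D_nonzero)
    then show ?thesis
      using sum_conv_T[OF uMz[unfolded Mz_def]] by (simp add: V_def Mz_def mult.assoc)
  qed
  have dT: "pdiv (P\<^sup>2) (T 1 / M1 - T z / Mz)"
  proof -
    \<comment> \<open>T z / Mz is itself a multiple of P and so is Mz - M1, so exchanging the
      denominators costs only a multiple of P^2.\<close>
    have "T 1 / M1 - T z / Mz = ((T 1 - T z) + T z / Mz * (Mz - M1)) / M1"
      using punit_nonzero[OF uM1] punit_nonzero[OF uMz] by (simp add: field_simps)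
    moreover have "pdiv (P\<^sup>2) ((T 1 - T z) + T z / Mz * (Mz - M1))"
      using cM by (intro pdiv_add pdiv_power2_T_diff pdiv_mult_pdiv pdiv_divide[OF pdiv_T uMz]) (simp add: pcong_def)
    ultimately show ?thesis
      by (simp add: pdiv_divide punit_power2[OF uM1])
  qed
  \<comment> \<open>Congruence modulo P is enough here: the difference will be multiplied by 1 -
    z.\<close>
  have VQ: "pcong P V (Qa a * balsum D \<alpha> a c e m 1)"
  proof -
    have aa: "pcong P a a" by (rule pcong_refl[OF punit_imp_pint[OF ua]])
    have "pcong P V ((1 / \<alpha>) ^ m * qpoch (D / 1) D m / ?X * balsum D \<alpha> a c e m 1)"
      unfolding V_def
      by (intro pcong_mult pcong_div pcong_power pcong_qpoch' pcong_balsum pcong_consts z1 aa ua punit_1 u\<alpha>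
        punit_mult u_qpoch_div[OF ua uaq] u_qpoch_mult[OF u1aq])
    moreover have "pcong P (Qa a) ((1 - a * 1) * (a - 1) / (1 - a)\<^sup>2 / \<alpha> ^ m
        * (1 / qpoch D D m - qpoch D D m / ?X) + 1 / (\<alpha> ^ m * qpoch D D m))"
      unfolding Qa_def
      by (intro pcong_add pcong_mult pcong_div pcong_power pcong_qpoch' pcong_diff pcong_consts z1 aa ua u1a
        punit_1 u\<alpha> punit_power punit_mult u_qpoch_div[OF ua uaq] u_qpoch_mult[OF u1aq] u_qpoch_D order_refl)
    moreover have "(1 - a * 1) * (a - 1) / (1 - a)\<^sup>2 / \<alpha> ^ m * (1 / qpoch D D m - qpoch D D m / ?X)
        + 1 / (\<alpha> ^ m * qpoch D D m) = (1 / \<alpha>) ^ m * qpoch (D / 1) D m / ?X"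
    proof -
      \<comment> \<open>With this -1 the two copies of 1/(D;D)_m in \<open>Qa\<close> cancel,
        leaving the quotient that V has at z = 1.\<close>
      have "(1 - a * 1) * (a - 1) / (1 - a)\<^sup>2 = - 1"
        using punit_nonzero[OF u1a] by (simp add: power2_eq_square divide_simps)
      then show ?thesis by (simp add: power_one_over right_diff_distrib)
    qed
    ultimately have "pcong P V ((1 / \<alpha>) ^ m * qpoch (D / 1) D m / ?X * balsum D \<alpha> a c e m 1)"
      "pcong P (Qa a) ((1 / \<alpha>) ^ m * qpoch (D / 1) D m / ?X)" by simp_all
    moreover from this(2) have "pcong P (Qa a * balsum D \<alpha> a c e m 1)
        ((1 / \<alpha>) ^ m * qpoch (D / 1) D m / ?X * balsum D \<alpha> a c e m 1)"
      by (intro pcong_mult pcong_balsum aa ua pcong_consts punit_1)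
    ultimately show ?thesis by (blast intro: pcong_trans pcong_sym)
  qed
  have "lhs a - rhs a = ((T 1 / M1 - T z / Mz) + (1 - z) * (V - Qa a * balsum D \<alpha> a c e m 1)) / (1 - q)"
    unfolding 1 2 rhs_def by (simp add: diff_divide_distrib add_divide_distrib algebra_simps)
  moreover have "pdiv (P\<^sup>2) ((T 1 / M1 - T z / Mz) + (1 - z) * (V - Qa a * balsum D \<alpha> a c e m 1))"
    using VQ pcong_sym[OF z1] by (intro pdiv_add dT pdiv_mult_pdiv) (simp_all add: pcong_def)
  ultimately show ?thesis
    by (simp add: pdiv_divide punit_power2[OF u1q])
qed

end

section \<open>The combined modulus\<close>

lemma coprime_linear:
  assumes "coeff p 0 = 1 \<or> coeff p 1 = 1" "f \<noteq> 0"
  shows "coprime [:[:p:]:] ([:[:[:f:]:]:] :: mpoly4)"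
proof -
  have "coprime p [:f:]"
    using assms by (metis coprime_primitive_const dvd_refl)
  then have "coprime [:[:[:f:]:]:] ([:[:p:]:] :: mpoly4)"
    using assms(2) by (intro coprime_const_poly) (simp_all add: coprime_commute)
  then show ?thesis by (simp add: coprime_commute)
qed

context wp_params
begin

text \<open>The units 1 - q^j come from coprimality of Phi_n and q^j - 1 when n does not divide j;
  those containing a have a coefficient 1 in a.\<close>

lemma wp_cyclo_PhiQ: "wp_cyclo n d m r (PhiQ n)"
proof -
  have n0: "0 < n" using n by simp
  have u: "punit (PhiQ n) (emb [:[:[:f:]:]:])" if "coprime f (cyclo n)" "f \<noteq> 0" for f
    unfolding PhiQ_eq using that by (intro punit_emb_const coprime_const_poly) simp_all
  have ul: "punit (PhiQ n) (emb [:[:f:]:])" if "coeff f 0 = 1 \<or> coeff f 1 = 1" for f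
  proof -
    have "coprime f [:cyclo n:]"
      using that cyclo_nonzero[OF n0] by (metis coprime_primitive_const dvd_refl)
    then show ?thesis
      unfolding PhiQ_eq using that by (intro punit_emb_const) auto
  qed
  have u1: "punit (PhiQ n) (1 - emb Vq ^ j)" if "\<not> n dvd j" for j
    unfolding one_minus_emb_Vq_power
  proof (rule u)
    have "coprime (- xpow1 j) (cyclo n)"
      using coprime_cyclo_xpow1[OF n0 that] unfolding coprime_minus_left_iff coprime_commute[of "xpow1 j"] .
    then show "coprime (1 - monom 1 j) (cyclo n)" by simp
    show "1 - monom (1::rat) j \<noteq> 0"
      using xpow1_nonzero[of j] that by (cases j) auto
  qed
  have "coprime (monom 1 1) (cyclo n)"
  proof (rule coprimeI)
    fix h :: "rat poly" assume h: "h dvd monom 1 1" "h dvd cyclo n"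
    have "h dvd xpow1 n" using h(2) cyclo_dvd[OF n0] by (rule dvd_trans)
    moreover have "monom (1::rat) n = monom 1 1 * monom 1 (n - 1)" using n by (simp add: mult_monom)
    then have "h dvd monom 1 n" using h(1) by simp
    ultimately have "h dvd monom 1 n - xpow1 n" by (rule dvd_diff[rotated])
    then show "is_unit h" by simp
  qed
  then have uq: "punit (PhiQ n) (emb Vq)"
    using u[of "monom 1 1"] Vq_power[of 1] by simp
  have one: "(1 :: mpoly4) = [:[:[:1:]:]:]" by (simp add: one_pCons)
  show ?thesis
  proof
    show "\<not> is_unit (PhiQ n)"
      using degree_cyclo[OF n0] n0 by (auto simp: PhiQ_eq is_unit_const_poly_iff is_unit_poly_iff)
    show "punit (PhiQ n) (emb Vq)" by (rule uq)
    show "punit (PhiQ n) (1 - emb Vq)" using u1[of 1] n by simp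
    show "punit (PhiQ n) (1 - emb Vq ^ (d * Suc i))" if "i < m" for i
      using not_n_dvd[OF that] by (rule u1)
    show "pcong (PhiQ n) (emb Vq ^ n) 1"
    proof -
      obtain k where k: "xpow1 n = cyclo n * k" using cyclo_dvd[OF n0] by (rule dvdE)
      have "emb Vq ^ n - 1 = emb (Vq ^ n - 1)" by (simp add: emb_simps emb_power)
      also have "Vq ^ n - 1 = PhiQ n * [:[:[:k:]:]:]"
        by (simp add: PhiQ_eq Vq_power one k mult.commute)
      finally have "pdiv (PhiQ n) (emb Vq ^ n - 1)"
        unfolding emb_simps by (simp add: pdiv_mult pdiv_emb)
      then show ?thesis by (simp add: pcong_def flip: emb_power)
    qed
    show "punit (PhiQ n) (emb Va)" unfolding Va_def by (rule ul) simp
    have "1 - Va = [:[:[:1, - 1:]:]:]" by (simp add: one Va_def)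
    then show "punit (PhiQ n) (1 - emb Va)" using ul[of "[:1, - 1:]"] by (metis coeff_pCons_0 emb_simps(2,5))
    have "Va - Vq ^ j = [:[:[:- monom 1 j, 1:]:]:]" for j by (simp add: Vq_power Va_def)
    then show "punit (PhiQ n) (emb Va - emb Vq ^ j)" for j
      using ul[of "[:- monom 1 j, 1:]"] by (simp flip: emb_simps emb_power)
    have "1 - Va * Vq ^ j = [:[:[:1, - monom 1 j:]:]:]" for j by (simp add: Vq_power Va_def one)
    then show "punit (PhiQ n) (1 - emb Va * emb Vq ^ j)" for j
      using ul[of "[:1, - monom 1 j:]"] by (simp flip: emb_simps emb_power)
  qed (use cyclo_nonzero[OF n0] in \<open>simp_all add: PhiQ_eq punit_emb_ce\<close>)
qed

theorem pdiv_lhs_rhs: "pdiv ((PhiQ n)\<^sup>2 * (1 - Va * Vq ^ n) * (Va - Vq ^ n)) (lhs a - rhs a)"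
proof -
  have n0: "0 < n" using n by simp
  define p1 p2 :: "rat poly poly" where "p1 = [:1, - monom 1 n:]" and "p2 = [:- monom 1 n, 1:]"
  have P1: "1 - Va * Vq ^ n = [:[:p1:]:]" by (simp add: p1_def Vq_power Va_def one_pCons)
  have P2: "Va - Vq ^ n = [:[:p2:]:]" by (simp add: p2_def Vq_power Va_def)
  have c1: "coeff p1 0 = 1 \<or> coeff p1 1 = 1" "degree p1 = 1"
    and c2: "coeff p2 0 = 1 \<or> coeff p2 1 = 1" "degree p2 = 1"
    by (simp_all add: p1_def p2_def)
  have uz: "punit [:[:p1:]:] z"
    using wp_modulus_linear(2)[OF c1, of "monom 1 n"] by (simp flip: emb_power add: Vq_power)
  \<comment> \<open>Modulo 1 - az the variable a is 1/z, because z is a unit there.\<close>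
  have "a - 1 / z = emb [:[:p1:]:] * (- 1 / z)"
    unfolding P1[symmetric] emb_simps emb_power by (simp add: field_simps)
  then have "pdiv [:[:p1:]:] (a - 1 / z)"
    using uz by (simp only: pdiv_mult[OF pdiv_emb] pint_divide pint_minus pint_1)
  then have "pdiv [:[:p1:]:] (lhs a - rhs a)"
    by (intro pdiv_linear[OF c1, of "1 / z"]) (simp_all add: pcong_def pint_divide uz)
  moreover have "a - z = emb [:[:p2:]:]"
    unfolding P2[symmetric] emb_simps emb_power ..
  then have "pdiv [:[:p2:]:] (a - z)" by (simp only: pdiv_emb)
  then have "pdiv [:[:p2:]:] (lhs a - rhs a)"
    by (intro pdiv_linear[OF c2, of z]) (simp_all add: pcong_def flip: emb_power)
  moreover have "pdiv ((PhiQ n)\<^sup>2) (lhs a - rhs a)"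
    by (rule wp_cyclo.pdiv_power2[OF wp_cyclo_PhiQ])
  moreover have "coprime ((PhiQ n)\<^sup>2) [:[:p1:]:]" "coprime ((PhiQ n)\<^sup>2) [:[:p2:]:]"
    unfolding PhiQ_eq using coprime_linear[OF c1(1) cyclo_nonzero[OF n0]] coprime_linear[OF c2(1) cyclo_nonzero[OF n0]]
    by (simp_all add: coprime_commute)
  moreover have "coprime [:[:p1:]:] ([:[:p2:]:] :: mpoly4)"
  proof (rule coprimeI)
    fix h :: mpoly4 assume h: "h dvd [:[:p1:]:]" "h dvd [:[:p2:]:]"
    \<comment> \<open>Eliminating a leaves 1 - z^2, a nonzero polynomial in q alone and hence
      coprime to the linear factor.\<close>
    then have "h dvd (1 - Va * Vq ^ n) + (Va - Vq ^ n) * Vq ^ n" unfolding P1 P2 by (intro dvd_add dvd_mult2)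
    also have "(1 - Va * Vq ^ n) + (Va - Vq ^ n) * Vq ^ n = 1 - Vq ^ (n + n)" by (simp add: algebra_simps power_add)
    also have "\<dots> = [:[:[:1 - monom 1 (n + n):]:]:]" by (simp add: Vq_power one_pCons)
    finally have "h dvd [:[:[:1 - monom 1 (n + n):]:]:]" .
    moreover have "1 - monom (1::rat) (n + n) \<noteq> 0" using xpow1_nonzero[of "n + n"] n by auto
    then have "coprime [:[:p1:]:] ([:[:[:1 - monom 1 (n + n):]:]:] :: mpoly4)"
      by (rule coprime_linear[OF c1(1)])
    ultimately show "is_unit h" using h(1) by (metis coprime_common_divisor)
  qed
  ultimately show ?thesis
    unfolding P1 P2 by (intro pdiv_coprime_mult) (simp_all only: coprime_mult_left_iff simp_thms)
qed

lemma powi_eqs: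
  "q powi (2 * int d * int k + r) = \<alpha> * D ^ (2 * k)"
  "q powi (2 * int d - 3 * r) / (c * e) = D\<^sup>2 / (\<alpha> ^ 3 * c * e)"
  "q powi (2 * r + int d * int k) = \<alpha>\<^sup>2 * D ^ k"
  "q powi (int d - r) / (c * e) = D / (\<alpha> * c * e)"
  "q powi ((r * (r - int n)) div int d) = 1 / \<alpha> ^ m"
proof -
  have D: "q powi (int d * int k) = D ^ k" for k
    unfolding of_nat_mult[symmetric] power_int_of_nat by (rule power_mult)
  have k: "q powi (int k * r) = \<alpha> ^ k" for k
    by (simp add: power_int_mult[of _ r] mult.commute)
  have "2 * int d * int k + r = r + int d * int (2 * k)" by simp
  then show "q powi (2 * int d * int k + r) = \<alpha> * D ^ (2 * k)"
    by (simp only: power_int_add V_nonzero emb_eq_0_iff D simp_thms)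
  have "2 * int d - 3 * r = int d * int 2 - int 3 * r" by simp
  then have "q powi (2 * int d - 3 * r) = D\<^sup>2 / \<alpha> ^ 3"
    by (simp only: power_int_diff V_nonzero emb_eq_0_iff D k simp_thms)
  then show "q powi (2 * int d - 3 * r) / (c * e) = D\<^sup>2 / (\<alpha> ^ 3 * c * e)" by simp
  have "2 * r + int d * int k = int 2 * r + int d * int k" by simp
  then show "q powi (2 * r + int d * int k) = \<alpha>\<^sup>2 * D ^ k"
    by (simp only: power_int_add V_nonzero emb_eq_0_iff D k simp_thms)
  show "q powi (int d - r) / (c * e) = D / (\<alpha> * c * e)"
    by (simp add: power_int_diff)
  \<comment> \<open>As n - r = d m, the integer division is exact.\<close>
  have "r * (r - int n) = - (int m * r) * int d" using nm by (simp add: algebra_simps)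
  moreover have "int d \<noteq> 0" using d by simp
  ultimately have "(r * (r - int n)) div int d = - (int m * r)"
    by (metis nonzero_mult_div_cancel_right)
  then show "q powi ((r * (r - int n)) div int d) = 1 / \<alpha> ^ m"
    by (simp only: power_int_minus k inverse_eq_divide)
qed

end

theorem theorem3p5:
  fixes n d :: nat and r :: int
  assumes "n > 1" and "d \<ge> 2" and "r \<in> {1, -1}"
    and "int n mod int d = r mod int d"
  shows "let q = emb Vq; a = emb Va; c = emb Vc; e = emb Ve;
             m = nat ((int n - r) div int d);
             D = q ^ d;
             Qqan = q powi ((r * (r - int n)) div int d) * (1 - a * q ^ n) * (a - q ^ n) / (1 - a)\<^sup>2
                      * (1 / qpoch D D m - qpoch D D m / (qpoch (D / a) D m * qpoch (a * D) D m))
                    + q powi ((r * (r - int n)) div int d) / qpoch D D m;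
             lhs = (\<Sum>k=0..m. qint q (2 * int d * int k + r)
                      * (qpoch (q powi r) D k)\<^sup>2 * qpoch (c * q powi r) D k * qpoch (e * q powi r) D k
                      * qpoch (a * q powi r) D k * qpoch (q powi r / a) D k
                      / ((qpoch D D k)\<^sup>2 * qpoch (D / c) D k * qpoch (D / e) D k
                         * qpoch (D / a) D k * qpoch (a * D) D k)
                      * (q powi (2 * int d - 3 * r) / (c * e)) ^ k);
             rhs = qint q (int n) * Qqan *
                    (\<Sum>k=0..m. qpoch (q powi (2 * r + int d * int k)) D (m - k)
                      * qpoch (q powi (int d - r) / (c * e)) D k * qpoch (a * q powi r) D k
                      * qpoch (q powi r / a) D k * qpoch (q powi r) D k
                      / (qpoch D D k * qpoch (D / c) D k * qpoch (D / e) D k)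
                      * q ^ (d * k))
         in rcong lhs rhs ((PhiQ n)\<^sup>2 * (1 - Va * Vq ^ n) * (Va - Vq ^ n))"
proof -
  define m where "m = nat ((int n - r) div int d)"
  have "int d dvd int n - r" using assms(4) by (simp add: mod_eq_dvd_iff)
  \<comment> \<open>As r \<le> 1 < n, the conversion by \<open>nat\<close> loses nothing.\<close>
  moreover have "0 \<le> (int n - r) div int d"
    using assms by (intro pos_imp_zdiv_nonneg_iff[THEN iffD2]) auto
  ultimately have "int n - r = int d * int m" by (simp add: m_def)
  then interpret wp_params n d m r
    using assms by unfold_locales auto
  have lhs: "(\<Sum>k=0..m. qint q (2 * int d * int k + r)
                      * (qpoch \<alpha> D k)\<^sup>2 * qpoch (c * \<alpha>) D k * qpoch (e * \<alpha>) D k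
                      * qpoch (a * \<alpha>) D k * qpoch (\<alpha> / a) D k
                      / ((qpoch D D k)\<^sup>2 * qpoch (D / c) D k * qpoch (D / e) D k
                         * qpoch (D / a) D k * qpoch (a * D) D k)
                      * (q powi (2 * int d - 3 * r) / (c * e)) ^ k) = lhs a"
    unfolding lhs_def vwp_def qint_def powi_eqs sum_divide_distrib atLeast0AtMost power2_eq_square[of "qpoch _ _ _"]
    by (intro sum.cong refl) (simp add: mult_ac)
  have Qa: "q powi ((r * (r - int n)) div int d) * (1 - a * q ^ n) * (a - q ^ n) / (1 - a)\<^sup>2
                      * (1 / qpoch D D m - qpoch D D m / (qpoch (D / a) D m * qpoch (a * D) D m))
                    + q powi ((r * (r - int n)) div int d) / qpoch D D m = Qa a"
    unfolding Qa_def powi_eqs by (simp add: mult_ac)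
  have bal: "(\<Sum>k=0..m. qpoch (q powi (2 * r + int d * int k)) D (m - k)
                      * qpoch (q powi (int d - r) / (c * e)) D k * qpoch (a * \<alpha>) D k
                      * qpoch (\<alpha> / a) D k * qpoch \<alpha> D k
                      / (qpoch D D k * qpoch (D / c) D k * qpoch (D / e) D k)
                      * q ^ (d * k)) = balsum D \<alpha> a c e m 1"
    unfolding balsum_def powi_eqs atLeast0AtMost power_mult
    by (intro sum.cong refl) (simp add: mult_ac)
  have "qint q (int n) = (1 - z) / (1 - q)" by (simp add: qint_def)
  then show ?thesis
    unfolding Let_def m_def[symmetric] lhs Qa bal using pdiv_lhs_rhs
    by (simp only: rcong_iff_pdiv rhs_def)
qed

end
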